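(* Let $A^0,B^0:\mathbb N_0^2\to\mathbb R$ be given by $$A^0_{(n_1,n_2)}=\frac{(\beta)_{n_1}(\beta)_{n_2}(1-\beta)_{n_1+n_2}}{(1)_{n_1}(1)_{n_2}(3\beta)_{n_1+n_2}},\qquad B^0_{(n_1,n_2)}=-\frac{(\beta)_{n_1+1}(\beta)_{n_2+1}(1-\beta)_{n_1+n_2+1}}{(1)_{n_1}(1)_{n_2}(3\beta)_{n_1+n_2+1}}.$$ (i) For any $\beta>0$, both series $\sum_{n\in\mathbb N_0^2}A^0_nr^n$ and $\sum_{n\in\mathbb N_0^2}B^0_nr^n$ converge locally uniformly in $(-1,1)^2$. Let $F_0$ and $G_0$ denote the respective sums. Then $F_0,G_0$ are analytic and symmetric and satisfy, for $\{j,k\}=\{1,2\}$, $$r_j(1-r_j)\partial_j^2F_0+(2\beta-2r_j)\partial_jF_0-\beta(1-\beta)F_0=(1-r_k)G_0,$$ $$\beta r_j\partial_jF_0-\beta r_k\partial_kF_0=-(r_j-r_k)G_0.$$ Moreover, $F_0$ coincides with the Appell function $F_0(r_1,r_2)=F_1^{\mathrm{Appell}}(1-\beta;\beta,\beta;3\beta;r_1,r_2)$, and is positive in $(-1,1)^2$. (ii) Suppose $\beta>1/3$. Then for any $L\in(0,1)$, $\sum_{n\in\mathbb N_0^2}|A^0_n|L^{n_2}<\infty$, and $F_0$ (the sum of the series) is continuous and positive on $[0,1]^2\setminus\{(1,1)\}$. Moreover, for any $n_1\in\mathbb N_0$ the following sum is absolutely convergent and $$A^\Sigma_{n_1}:=\sum_{n_2=0}^\infty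 A^0_{(n_1,n_2)}=\frac{\Gamma(3\beta)\Gamma(3\beta-1)}{\Gamma(2\beta)\Gamma(4\beta-1)}\cdot\frac{(\beta)_{n_1}(1-\beta)_{n_1}}{(1)_{n_1}(2\beta)_{n_1}},$$ and $F_0$ has boundary values $$F_0(x,1)=F_0(1,x)=\frac{\Gamma(3\beta)\Gamma(3\beta-1)}{\Gamma(2\beta)\Gamma(4\beta-1)}\cdot f_\beta(x),\quad x\in[0,1).$$ (iii) Suppose $\beta>1/2$. Then $\sum_{n\in\mathbb N_0^2}|A^0_n|<\infty$, and $F_0$ is continuous and positive on $[0,1]^2$ with $$F_0(1,1)=\frac{\Gamma(3\beta)\Gamma(2\beta-1)}{\Gamma(\beta)\Gamma(4\beta-1)}.$$
   Context: $\mathbb N_0=\{0,1,2,\dots\}$, $r^n=r_1^{n_1}r_2^{n_2}$, $\partial_j=\partial_{r_j}$, $(q)_m=q(q+1)\cdots(q+m-1)$, $(q)_0=1$ (Pochhammer symbol). $f_\beta(x)={}_2F_1(1-\beta,\beta;2\beta;x)$. The Appell function is $F_1^{\mathrm{Appell}}(a;b,b';c;x,y)=\sum_{m,n\ge0}\frac{(a)_{m+n}(b)_m(b')_n}{(c)_{m+n}\,m!\,n!}x^my^n$ for $|x|,|y|<1$. *)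

theory Defs
  imports "HOL-Analysis.Analysis"
begin

definition A0 :: "real \<Rightarrow> nat \<times> nat \<Rightarrow> real" where
  "A0 \<beta> = (\<lambda>(n1, n2).
     (pochhammer \<beta> n1 * pochhammer \<beta> n2 * pochhammer (1 - \<beta>) (n1 + n2)) /
     (pochhammer 1 n1 * pochhammer 1 n2 * pochhammer (3 * \<beta>) (n1 + n2)))"

definition B0 :: "real \<Rightarrow> nat \<times> nat \<Rightarrow> real" where
  "B0 \<beta> = (\<lambda>(n1, n2).
     - ((pochhammer \<beta> (n1 + 1) * pochhammer \<beta> (n2 + 1) * pochhammer (1 - \<beta>) (n1 + n2 + 1)) /
        (pochhammer 1 n1 * pochhammer 1 n2 * pochhammer (3 * \<beta>) (n1 + n2 + 1))))"

definition mpow :: "real \<times> real \<Rightarrow> nat \<times> nat \<Rightarrow> real" where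
  "mpow r n = fst r ^ fst n * snd r ^ snd n"

definition F0 :: "real \<Rightarrow> real \<times> real \<Rightarrow> real" where
  "F0 \<beta> r = (\<Sum>\<^sub>\<infinity>n. A0 \<beta> n * mpow r n)"

definition G0 :: "real \<Rightarrow> real \<times> real \<Rightarrow> real" where
  "G0 \<beta> r = (\<Sum>\<^sub>\<infinity>n. B0 \<beta> n * mpow r n)"

definition A_Sigma :: "real \<Rightarrow> nat \<Rightarrow> real" where
  "A_Sigma \<beta> n1 = (\<Sum>n2. A0 \<beta> (n1, n2))"

definition f_beta :: "real \<Rightarrow> real \<Rightarrow> real" where
  "f_beta \<beta> x = eval_fps (fps_hypergeo [1 - \<beta>, \<beta>] [2 * \<beta>] 1) x"

text \<open>The factor \<open>n!\<close> of the hypergeometric series is built into \<open>fps_hypergeo\<close>; its last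
  argument rescales the variable.\<close>

lemma f_beta_eq:
  "f_beta \<beta> x = (\<Sum>n. pochhammer (1 - \<beta>) n * pochhammer \<beta> n / (pochhammer (2 * \<beta>) n * fact n) * x ^ n)"
  by (simp add: f_beta_def eval_fps_def mult_ac)

definition Appell_F1 :: "real \<Rightarrow> real \<Rightarrow> real \<Rightarrow> real \<Rightarrow> real \<Rightarrow> real \<Rightarrow> real" where
  "Appell_F1 a b b' c x y = (\<Sum>\<^sub>\<infinity>(m, n).
     (pochhammer a (m + n) * pochhammer b m * pochhammer b' n) /
     (pochhammer c (m + n) * fact m * fact n) * x ^ m * y ^ n)"

text \<open>Locally uniform convergence on \<open>S\<close> of a series without a preferred order of summation:
  the net of all finite partial sums converges uniformly near each point of \<open>S\<close>.\<close>

definition has_sum_locally_uniformly ::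
  "('i \<Rightarrow> 'a::topological_space \<Rightarrow> real) \<Rightarrow> ('a \<Rightarrow> real) \<Rightarrow> 'a set \<Rightarrow> bool" where
  "has_sum_locally_uniformly f g S \<longleftrightarrow>
     (\<forall>x\<in>S. \<exists>U. open U \<and> x \<in> U \<and>
        uniform_limit (U \<inter> S) (\<lambda>N r. \<Sum>n\<in>N. f n r) g (finite_subsets_at_top UNIV))"

text \<open>Real analyticity in two variables on an open set; the library's \<open>analytic_on\<close>
  concerns functions of one complex variable.\<close>

definition real_analytic2_on :: "(real \<times> real \<Rightarrow> real) \<Rightarrow> (real \<times> real) set \<Rightarrow> bool" where
  "real_analytic2_on f S \<longleftrightarrow>
     (\<forall>p\<in>S. \<exists>c. \<exists>\<rho>>0. \<forall>r. \<bar>fst r - fst p\<bar> < \<rho> \<and> \<bar>snd r - snd p\<bar> < \<rho> \<longrightarrow>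
        ((\<lambda>n. c n * mpow (r - p) n) has_sum f r) UNIV)"

definition pd1 :: "(real \<times> real \<Rightarrow> real) \<Rightarrow> real \<times> real \<Rightarrow> real" where
  "pd1 f = (\<lambda>(r1, r2). deriv (\<lambda>t. f (t, r2)) r1)"

definition pd2 :: "(real \<times> real \<Rightarrow> real) \<Rightarrow> real \<times> real \<Rightarrow> real" where
  "pd2 f = (\<lambda>(r1, r2). deriv (\<lambda>t. f (r1, t)) r2)"

end

theory Submission
  imports Defs "HOL-Real_Asymp.Real_Asymp"
begin

text \<open>The coefficients of \<open>F\<^sub>0\<close> are at most of the order
  \<open>(n\<^sub>1 + 1) powr (\<beta> - 1) * (n\<^sub>2 + 1) powr (\<beta> - 1) * (n\<^sub>1 + n\<^sub>2 + 1) powr (1 - 4 * \<beta>)\<close>,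
  which gives all the convergence statements by the Weierstrass test; the differential equations are
  identities between coefficients. The row sums \<open>A\<^sup>\<Sigma>\<close> and the value at \<open>(1, 1)\<close> are instances of
  Gauss's summation theorem, obtained by iterating his contiguous relation between the parameters
  \<open>c\<close> and \<open>c + 1\<close>. For positivity let \<open>S\<close>, \<open>T\<close> be independent with laws Beta\<open>(2\<beta>, \<beta>)\<close> and
  Beta\<open>(\<beta>, \<beta>)\<close>. Then \<open>F\<^sub>0(x, y)\<close> is the expectation of
  \<open>(1 - S * (T * x + (1 - T) * y)) powr (\<beta> - 1)\<close>, whose base stays in a compact subset of \<open>(0, 2)\<close>.
  Only polynomials have to be integrated, namely the partial sums of the binomial series, which are
  eventually bounded below by a positive constant. This works for all \<open>\<beta> > 0\<close>, whereas Euler's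
  integral for the Appell function needs \<open>1/4 < \<beta> < 1\<close>.\<close>

section \<open>Growth of Pochhammer symbols and Gauss's summation theorem\<close>

text \<open>Euler's limit for 1/Gamma, rewritten with the weight
  \<open>(real n + 1) powr (x - 1)\<close>, which is positive also at \<open>n = 0\<close>. Using
  \<open>rGamma\<close> covers every real \<open>x\<close>; at the poles of \<open>Gamma\<close> the
  limit is 0.\<close>

lemma pochhammer_asymp:
  fixes x :: real
  shows "(\<lambda>n. pochhammer x n / (fact n * (real n + 1) powr (x - 1))) \<longlonglongrightarrow> rGamma x"
proof -
  \<comment> \<open>\<open>rGamma_series x n\<close> contains \<open>pochhammer x (Suc n)\<close>,
    so it is compared with the wanted quotient at \<open>Suc n\<close>. This is the quotient of the
    two normalisations.\<close>
  have lim: "(\<lambda>n. real n powr x / ((real n + 1) * (real n + 2) powr (x - 1))) \<longlonglongrightarrow> 1"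
    by real_asymp
  have "(\<lambda>n. rGamma_series x n * (real n powr x / ((real n + 1) * (real n + 2) powr (x - 1))))
          \<longlonglongrightarrow> rGamma x"
    using tendsto_mult[OF rGamma_series_LIMSEQ lim] by simp
  moreover have "eventually (\<lambda>n. rGamma_series x n * (real n powr x / ((real n + 1) * (real n + 2) powr (x - 1)))
       = pochhammer x (Suc n) / (fact (Suc n) * (real (Suc n) + 1) powr (x - 1))) sequentially"
    using eventually_gt_at_top[of 0]
    by eventually_elim (simp add: rGamma_series_def powr_def field_simps)
  ultimately have "(\<lambda>n. pochhammer x (Suc n) / (fact (Suc n) * (real (Suc n) + 1) powr (x - 1)))
          \<longlonglongrightarrow> rGamma x"
    by (rule Lim_transform_eventually)
  thus ?thesis by (rule LIMSEQ_imp_Suc)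
qed

lemma pochhammer_upper_bound:
  fixes x :: real
  obtains C where "C > 0" "\<And>n. \<bar>pochhammer x n\<bar> \<le> C * (fact n * (real n + 1) powr (x - 1))"
proof -
  obtain C where C: "C > 0"
    "\<And>n. norm (pochhammer x n / (fact n * (real n + 1) powr (x - 1))) \<le> C"
    using convergent_imp_Bseq[OF convergentI[OF pochhammer_asymp[of x]]] by (rule BseqE) blast
  show ?thesis
  proof
    show "\<bar>pochhammer x n\<bar> \<le> C * (fact n * (real n + 1) powr (x - 1))" for n
      using C(2)[of n] by (simp add: divide_simps abs_mult split: if_splits)
  qed fact
qed

text \<open>For \<open>x > 0\<close> the limit \<open>rGamma x\<close> is not 0, so the reciprocal
  quotients converge too and are therefore bounded.\<close>

lemma pochhammer_lower_bound:
  fixes x :: real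
  assumes "x > 0"
  obtains C where "C > 0" "\<And>n. fact n * (real n + 1) powr (x - 1) \<le> C * pochhammer x n"
proof -
  have "rGamma x \<noteq> 0" using Gamma_real_pos[OF assms] by (simp add: rGamma_inverse_Gamma)
  hence lim: "(\<lambda>n. inverse (pochhammer x n / (fact n * (real n + 1) powr (x - 1))))
          \<longlonglongrightarrow> inverse (rGamma x)"
    by (intro tendsto_inverse pochhammer_asymp)
  from convergent_imp_Bseq[OF convergentI[OF lim]] obtain C where C: "C > 0"
    "\<And>n. norm (inverse (pochhammer x n / (fact n * (real n + 1) powr (x - 1)))) \<le> C"
    by (rule BseqE) blast
  show ?thesis
  proof
    show "fact n * (real n + 1) powr (x - 1) \<le> C * pochhammer x n" for n
      using C(2)[of n] pochhammer_pos[OF assms, of n]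
      by (simp add: divide_simps abs_mult split: if_splits)
  qed fact
qed

lemma pochhammer_ratio_bound:
  fixes a b :: real
  assumes "b > 0"
  obtains C where "C > 0" "\<And>n. \<bar>pochhammer a n / pochhammer b n\<bar> \<le> C * (real n + 1) powr (a - b)"
proof -
  obtain C where C: "C > 0" "\<And>n. \<bar>pochhammer a n\<bar> \<le> C * (fact n * (real n + 1) powr (a - 1))"
    using pochhammer_upper_bound by blast
  obtain D where D: "D > 0" "\<And>n. fact n * (real n + 1) powr (b - 1) \<le> D * pochhammer b n"
    using pochhammer_lower_bound[OF assms] by blast
  show ?thesis
  proof
    show "C * D > 0" using C D by simp
    fix n
    have pos: "pochhammer b n > 0" using pochhammer_pos[OF assms] .
    have "\<bar>pochhammer a n\<bar> \<le> C * (real n + 1) powr (a - b) * (fact n * (real n + 1) powr (b - 1))"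
      using C(2)[of n] by (simp add: mult_ac flip: powr_add)
    also have "\<dots> \<le> C * (real n + 1) powr (a - b) * (D * pochhammer b n)"
      using C(1) by (intro mult_left_mono D(2)) auto
    finally show "\<bar>pochhammer a n / pochhammer b n\<bar> \<le> C * D * (real n + 1) powr (a - b)"
      using pos by (simp add: divide_simps mult_ac)
  qed
qed

lemma summable_Suc_powr:
  fixes s :: real
  assumes "s < -1"
  shows "summable (\<lambda>n. (real n + 1) powr s)"
  using assms summable_real_powr_iff[of s] summable_Suc_iff[of "\<lambda>n. real n powr s"]
  by (simp add: add_ac)

section \<open>Gauss's summation theorem\<close>

text \<open>The exponent is below -1 as soon as \<open>c - a - b > 0\<close>, which gives absolute
  convergence. The same bound makes \<open>n\<close> times the term tend to 0, as the telescoping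
  argument requires.\<close>

lemma Gauss_term_bound:
  fixes a b c :: real
  assumes "c > 0"
  obtains C where "C > 0"
    "\<And>n. \<bar>pochhammer a n * pochhammer b n / (pochhammer c n * fact n)\<bar>
            \<le> C * (real n + 1) powr (a + b - c - 1)"
proof -
  obtain C where C: "C > 0" "\<And>n. \<bar>pochhammer a n\<bar> \<le> C * (fact n * (real n + 1) powr (a - 1))"
    using pochhammer_upper_bound by blast
  obtain D where D: "D > 0" "\<And>n. \<bar>pochhammer b n / pochhammer c n\<bar> \<le> D * (real n + 1) powr (b - c)"
    using pochhammer_ratio_bound[OF assms] by blast
  show ?thesis
  proof
    show "C * D > 0" using C D by simp
    fix n
    have "\<bar>pochhammer a n * pochhammer b n / (pochhammer c n * fact n)\<bar>
        = (\<bar>pochhammer a n\<bar> / fact n) * \<bar>pochhammer b n / pochhammer c n\<bar>"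
      by (simp add: abs_mult)
    also have "\<dots> \<le> (C * (real n + 1) powr (a - 1)) * (D * (real n + 1) powr (b - c))"
      using C(2)[of n] C(1) by (intro mult_mono D(2)) (auto simp: field_simps)
    also have "\<dots> = C * D * (real n + 1) powr (a + b - c - 1)"
    proof -
      have "a + b - c - 1 = (a - 1) + (b - c)" by simp
      thus ?thesis by (simp only: powr_add mult_ac)
    qed
    finally show "\<bar>pochhammer a n * pochhammer b n / (pochhammer c n * fact n)\<bar>
       \<le> C * D * (real n + 1) powr (a + b - c - 1)" .
  qed
qed

lemma Gauss_summable:
  fixes a b c :: real
  assumes "c > 0" "c - a - b > 0"
  shows "summable (\<lambda>n. \<bar>pochhammer a n * pochhammer b n / (pochhammer c n * fact n)\<bar>)"
proof -
  obtain C where C: "\<And>n. \<bar>pochhammer a n * pochhammer b n / (pochhammer c n * fact n)\<bar>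
            \<le> C * (real n + 1) powr (a + b - c - 1)"
    using Gauss_term_bound[OF assms(1)] by metis
  have "summable (\<lambda>n. C * (real n + 1) powr (a + b - c - 1))"
    using assms by (intro summable_mult summable_Suc_powr) auto
  thus ?thesis
    by (rule summable_comparison_test[rotated]) (use C in auto)
qed

definition Gauss_F :: "real \<Rightarrow> real \<Rightarrow> real \<Rightarrow> real" where
  "Gauss_F a b c = (\<Sum>n. pochhammer a n * pochhammer b n / (pochhammer c n * fact n))"

text \<open>With \<open>u\<close> and \<open>v\<close> the terms for \<open>c\<close> and
  \<open>c + 1\<close>, the combination
  \<open>c * (c - a - b) * u n - (c - a) * (c - b) * v n\<close> is the difference of consecutive
  values of \<open>c * n * u n\<close>, up to sign. Hence the series telescopes.\<close>

lemma Gauss_contiguous: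
  assumes "c > 0" "c - a - b > 0"
  shows "c * (c - a - b) * Gauss_F a b c = (c - a) * (c - b) * Gauss_F a b (c + 1)"
proof -
  define u where "u n = pochhammer a n * pochhammer b n / (pochhammer c n * fact n)" for n
  define v where "v n = pochhammer a n * pochhammer b n / (pochhammer (c + 1) n * fact n)" for n
  have su: "u sums Gauss_F a b c"
    using Gauss_summable[OF assms] unfolding u_def Gauss_F_def
    by (intro summable_sums) (rule summable_rabs_cancel)
  have sv: "v sums Gauss_F a b (c + 1)"
    using Gauss_summable[of "c + 1" a b] assms unfolding v_def Gauss_F_def
    by (intro summable_sums) (rule summable_rabs_cancel, simp)
  have vu: "v n = c / (c + n) * u n" for n
  proof -
    have *: "pochhammer (c + 1) n = (c + n) * pochhammer c n / c"
      using pochhammer_rec[of c n] pochhammer_rec'[of c n] assms by (simp add: field_simps)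
    have "pochhammer c n \<noteq> 0" "c + n \<noteq> 0" "c \<noteq> 0"
      using assms pochhammer_pos[of c n] by auto
    thus ?thesis unfolding u_def v_def * by (simp add: divide_simps)
  qed
  have us: "u (Suc n) = u n * ((a + n) * (b + n)) / ((c + n) * (real n + 1))" for n
  proof -
    have "real (Suc n) = real n + 1" by simp
    thus ?thesis unfolding u_def pochhammer_rec' fact_Suc of_nat_mult
      by (simp only: times_divide_eq_left times_divide_eq_right divide_divide_eq_left mult_ac)
  qed
  have tel: "c * (real n * u n - real (Suc n) * u (Suc n))
      = c * (c - a - b) * u n - (c - a) * (c - b) * v n" for n
  proof -
    \<comment> \<open>All three quantities in the identity are polynomial multiples of
      \<open>q\<close>, so no division remains.\<close>
    define q where "q = u n / (c + n)"
    have "c + n > 0" using assms by simp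
    moreover have "real (Suc n) * (x / (y * (real n + 1))) = x / y" for x y :: real
      by (simp add: add_ac)
    ultimately have u: "u n = q * (c + n)" and v: "v n = c * q" and u': "real (Suc n) * u (Suc n) = q * ((a + n) * (b + n))"
      unfolding us vu by (simp_all add: q_def del: of_nat_Suc)
    show ?thesis unfolding u v u' by algebra
  qed
  have "(\<lambda>n. real n * u n) \<longlonglongrightarrow> 0"
  proof -
    obtain C where C: "C > 0" "\<And>n. \<bar>u n\<bar> \<le> C * (real n + 1) powr (a + b - c - 1)"
      using Gauss_term_bound[OF assms(1), of a b] unfolding u_def by metis
    have "filterlim (\<lambda>n. real n + 1) at_top sequentially" by real_asymp
    hence "(\<lambda>n. (real n + 1) powr (a + b - c)) \<longlonglongrightarrow> 0"
      using assms by (intro tendsto_neg_powr) auto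
    hence "(\<lambda>n. C * (real n + 1) powr (a + b - c)) \<longlonglongrightarrow> C * 0"
      by (intro tendsto_mult tendsto_const)
    moreover have "norm (real n * u n) \<le> C * (real n + 1) powr (a + b - c)" for n
    proof -
      have "norm (real n * u n) \<le> (real n + 1) * (C * (real n + 1) powr (a + b - c - 1))"
        unfolding norm_mult unfolding real_norm_def by (intro mult_mono C(2)) auto
      also have "\<dots> = C * ((real n + 1) powr 1 * (real n + 1) powr (a + b - c - 1))"
        by simp
      also have "\<dots> = C * (real n + 1) powr (a + b - c)"
        unfolding powr_add [symmetric] by (simp add: algebra_simps)
      finally show ?thesis .
    qed
    ultimately show ?thesis
      by (simp add: Lim_null_comparison[where g = "\<lambda>n. C * (real n + 1) powr (a + b - c)"])
  qed
  \<comment> \<open>The factor \<open>real n\<close> makes the initial value 0 and the limit at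
    infinity is 0, so the differences sum to 0.\<close>
  from sums_mult[OF telescope_sums'[OF this], of c]
  have "(\<lambda>n. c * (c - a - b) * u n - (c - a) * (c - b) * v n) sums 0"
    unfolding tel by simp
  moreover have "(\<lambda>n. c * (c - a - b) * u n - (c - a) * (c - b) * v n) sums
     (c * (c - a - b) * Gauss_F a b c - (c - a) * (c - b) * Gauss_F a b (c + 1))"
    by (intro sums_diff sums_mult su sv)
  ultimately have "c * (c - a - b) * Gauss_F a b c - (c - a) * (c - b) * Gauss_F a b (c + 1) = 0"
    by (rule sums_unique2[symmetric])
  thus ?thesis by simp
qed

text \<open>The linear factors met at \<open>c\<close>, \<open>c + 1\<close>, ...,
  \<open>c + m - 1\<close> collect into Pochhammer symbols. Since \<open>c - a - b\<close> grows by
  1 at each step, the relation stays applicable.\<close>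

lemma Gauss_iterated:
  assumes "c > 0" "c - a - b > 0"
  shows "pochhammer c m * pochhammer (c - a - b) m * Gauss_F a b c
       = pochhammer (c - a) m * pochhammer (c - b) m * Gauss_F a b (c + m)"
proof (induction m)
  case (Suc m)
  have "(c + m) * (c + m - a - b) * Gauss_F a b (c + m)
      = (c + m - a) * (c + m - b) * Gauss_F a b (c + Suc m)"
    using Gauss_contiguous[of "c + m" a b] assms by (simp add: add_ac)
  hence *: "(c + m) * (c - a - b + m) * Gauss_F a b (c + m)
      = (c - a + m) * (c - b + m) * Gauss_F a b (c + Suc m)"
    by (simp add: algebra_simps)
  have "pochhammer c (Suc m) * pochhammer (c - a - b) (Suc m) * Gauss_F a b c
      = (c + m) * (c - a - b + m) * (pochhammer c m * pochhammer (c - a - b) m * Gauss_F a b c)"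
    unfolding pochhammer_rec' by (simp only: mult_ac)
  also have "\<dots> = pochhammer (c - a) m * pochhammer (c - b) m *
      ((c + m) * (c - a - b + m) * Gauss_F a b (c + m))"
    unfolding Suc.IH by (simp only: mult_ac)
  also have "\<dots> = pochhammer (c - a) (Suc m) * pochhammer (c - b) (Suc m) * Gauss_F a b (c + Suc m)"
    unfolding * pochhammer_rec' by (simp only: mult_ac)
  finally show ?case .
qed simp

text \<open>Every term with positive index is at most \<open>c / (c + m)\<close> times its modulus
  at \<open>m = 0\<close>: the first Pochhammer factor yields this quotient and the others only
  grow. So only the term of index 0, which is 1, survives.\<close>

lemma Gauss_F_shift_tendsto:
  assumes "c > 0" "c - a - b > 0"
  shows "(\<lambda>m. Gauss_F a b (c + real m)) \<longlonglongrightarrow> 1"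
proof -
  define u where "u m n = pochhammer a n * pochhammer b n / (pochhammer (c + real m) n * fact n)" for m n
  have summ: "summable (\<lambda>n. \<bar>u m n\<bar>)" for m
    unfolding u_def using assms by (intro Gauss_summable) auto
  define T where "T = (\<Sum>n. \<bar>u 0 (Suc n)\<bar>)"
  have le: "\<bar>u m (Suc n)\<bar> \<le> c / (c + m) * \<bar>u 0 (Suc n)\<bar>" for m n
  proof -
    have "pochhammer (c + 1) n \<le> pochhammer (c + m + 1) n"
      unfolding pochhammer_prod using assms by (intro prod_mono) auto
    moreover have "pochhammer (c + 1) n > 0" "pochhammer (c + m + 1) n > 0"
      using assms by (auto intro!: pochhammer_pos)
    ultimately have "1 / (pochhammer (c + m) (Suc n)) \<le> c / (c + m) * (1 / pochhammer c (Suc n))"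
      using assms by (simp add: pochhammer_rec frac_le)
    hence "\<bar>pochhammer a (Suc n) * pochhammer b (Suc n)\<bar> / fact (Suc n) * (1 / (pochhammer (c + m) (Suc n)))
      \<le> \<bar>pochhammer a (Suc n) * pochhammer b (Suc n)\<bar> / fact (Suc n) * (c / (c + m) * (1 / pochhammer c (Suc n)))"
      by (intro mult_left_mono) auto
    moreover have "pochhammer (c + m) (Suc n) > 0" "pochhammer c (Suc n) > 0"
      using assms by (auto intro!: pochhammer_pos)
    ultimately show ?thesis by (simp add: u_def abs_mult mult_ac)
  qed
  have "norm (Gauss_F a b (c + real m) - 1) \<le> T * (c / (c + m))" for m
  proof -
    have s: "summable (\<lambda>n. \<bar>u m (Suc n)\<bar>)" "summable (\<lambda>n. \<bar>u 0 (Suc n)\<bar>)"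
      using summ summable_Suc_iff[of "\<lambda>n. \<bar>u _ n\<bar>"] by blast+
    have "Gauss_F a b (c + real m) - 1 = (\<Sum>n. u m (Suc n))"
      using suminf_split_head[OF summable_rabs_cancel[OF summ], of m]
      by (simp add: Gauss_F_def u_def)
    also have "\<bar>\<dots>\<bar> \<le> (\<Sum>n. \<bar>u m (Suc n)\<bar>)"
      by (intro summable_rabs s)
    also have "\<dots> \<le> (\<Sum>n. c / (c + m) * \<bar>u 0 (Suc n)\<bar>)"
      by (intro suminf_le le s summable_mult)
    also have "\<dots> = T * (c / (c + m))"
      by (subst suminf_mult[OF s(2)]) (simp add: T_def mult_ac)
    finally show ?thesis by simp
  qed
  moreover have "(\<lambda>m. T * (c / (c + real m))) \<longlonglongrightarrow> T * 0"
    by (intro tendsto_mult tendsto_divide_0[OF tendsto_const] tendsto_const filterlim_at_top_imp_at_infinity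
          filterlim_tendsto_add_at_top[OF tendsto_const] filterlim_real_sequentially)
  ultimately have "(\<lambda>m. Gauss_F a b (c + real m) - 1) \<longlonglongrightarrow> 0"
    by (simp add: Lim_null_comparison[where g = "\<lambda>m. T * (c / (c + real m))"])
  thus ?thesis by (simp add: LIM_zero_iff)
qed

text \<open>Normalise the Pochhammer symbols of the iterated relation and let the number of steps
  tend to infinity: each symbol becomes an \<open>rGamma\<close>. As \<open>c - a\<close> and
  \<open>c - b\<close> may be nonpositive, \<open>rGamma\<close> is kept on the right.\<close>

theorem Gauss_summation:
  assumes "c > 0" "c - a - b > 0"
  shows "Gauss_F a b c = Gamma c * Gamma (c - a - b) * rGamma (c - a) * rGamma (c - b)"
proof -
  define p where "p x n = pochhammer x n / (fact n * (real n + 1) powr (x - 1))" for x n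
  have p: "p x \<longlonglongrightarrow> rGamma x" for x
    unfolding p_def by (rule pochhammer_asymp)
  have eq: "p c n * p (c - a - b) n * Gauss_F a b c = p (c - a) n * p (c - b) n * Gauss_F a b (c + n)" for n
  proof -
    \<comment> \<open>The weights on the two sides agree because
      \<open>c + (c - a - b) = (c - a) + (c - b)\<close>.\<close>
    have "(real n + 1) powr (c - 1) * (real n + 1) powr (c - a - b - 1)
        = (real n + 1) powr (c - a - 1) * (real n + 1) powr (c - b - 1)"
      by (simp flip: powr_add add: algebra_simps)
    thus ?thesis using Gauss_iterated[OF assms, of n]
      by (simp add: p_def field_simps)
  qed
  have "(\<lambda>n. p c n * p (c - a - b) n * Gauss_F a b c) \<longlonglongrightarrow> rGamma c * rGamma (c - a - b) * Gauss_F a b c"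
    by (intro tendsto_intros p)
  moreover have "(\<lambda>n. p c n * p (c - a - b) n * Gauss_F a b c) \<longlonglongrightarrow> rGamma (c - a) * rGamma (c - b) * 1"
    unfolding eq by (intro tendsto_mult p Gauss_F_shift_tendsto assms)
  ultimately have "rGamma c * rGamma (c - a - b) * Gauss_F a b c = rGamma (c - a) * rGamma (c - b) * 1"
    by (rule LIMSEQ_unique)
  hence "rGamma c * rGamma (c - a - b) * Gauss_F a b c = rGamma (c - a) * rGamma (c - b)"
    by simp
  hence "Gamma c * Gamma (c - a - b) * (rGamma c * rGamma (c - a - b) * Gauss_F a b c)
      = Gamma c * Gamma (c - a - b) * (rGamma (c - a) * rGamma (c - b))"
    by (rule arg_cong)
  hence "(Gamma c * rGamma c) * (Gamma (c - a - b) * rGamma (c - a - b)) * Gauss_F a b c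
      = Gamma c * Gamma (c - a - b) * rGamma (c - a) * rGamma (c - b)"
    by (simp only: mult_ac)
  moreover have "Gamma x * rGamma x = 1" if "x > 0" for x :: real
    using Gamma_real_pos[OF that] by (simp add: rGamma_inverse_Gamma)
  ultimately show ?thesis using assms by simp
qed

section \<open>Beta integrals and the binomial series\<close>

lemma Gamma_plus_nat:
  fixes x :: real
  assumes "x > 0"
  shows "Gamma (x + real k) = pochhammer x k * Gamma x"
proof -
  have "x \<notin> \<int>\<^sub>\<le>\<^sub>0" using assms by (auto elim!: nonpos_Ints_cases)
  thus ?thesis using pochhammer_Gamma[of x k] Gamma_real_pos[OF assms] by simp
qed

text \<open>These are the moments of the unnormalised Beta law. The integral is
  \<open>Beta (a + i) (b + j)\<close>, and the functional equation of Gamma turns its quotient by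
  \<open>Beta a b\<close> into Pochhammer symbols.\<close>

lemma beta_moment:
  fixes a b :: real
  assumes "a > 0" "b > 0"
  shows "((\<lambda>t. t ^ i * (1 - t) ^ j * (t powr (a - 1) * (1 - t) powr (b - 1))) has_integral
            Beta a b * (pochhammer a i * pochhammer b j / pochhammer (a + b) (i + j))) {0..1}"
proof -
  have "((\<lambda>t. t powr (a + i - 1) * (1 - t) powr (b + j - 1)) has_integral Beta (a + i) (b + j)) {0..1}"
    using assms by (intro has_integral_Beta_real) auto
  also have "Beta (a + i) (b + j) = Beta a b * (pochhammer a i * pochhammer b j / pochhammer (a + b) (i + j))"
  proof -
    have "a + i + (b + j) = a + b + (i + j)" by simp
    hence G': "Gamma (a + i + (b + j)) = pochhammer (a + b) (i + j) * Gamma (a + b)"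
      using Gamma_plus_nat[of "a + b" "i + j"] assms by (simp only: add_pos_pos)
    show ?thesis unfolding Beta_def Gamma_plus_nat[OF assms(1)] Gamma_plus_nat[OF assms(2)] G'
      by (simp only: times_divide_times_eq mult_ac)
  qed
  finally show ?thesis
  proof (rule has_integral_eq[rotated])
    fix t :: real assume t: "t \<in> {0..1}"
    \<comment> \<open>At \<open>s = 0\<close> both sides are 0, since \<open>0 powr x = 0\<close>
      for every \<open>x\<close>.\<close>
    have *: "s powr (x + real k - 1) = s ^ k * s powr (x - 1)" if "s \<ge> 0" for s x :: real and k
    proof (cases "s = 0")
      case False
      have "s powr (x + real k - 1) = s powr (real k + (x - 1))" by (simp add: algebra_simps)
      thus ?thesis using that False by (simp only: powr_add powr_realpow)
    qed auto
    show "t powr (a + i - 1) * (1 - t) powr (b + j - 1)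
       = t ^ i * (1 - t) ^ j * (t powr (a - 1) * (1 - t) powr (b - 1))"
      using t by (simp add: * mult_ac)
  qed
qed

text \<open>Replacing each monomial by its Beta moment is integration against a probability density,
  so it preserves pointwise lower bounds of polynomials. The polynomial is given by an arbitrary
  finite family of monomials, so that double sums fit as well.\<close>

lemma beta_mean_lower_bound:
  fixes a b :: real
  assumes "a > 0" "b > 0" "finite S"
    and "\<And>t. 0 \<le> t \<Longrightarrow> t \<le> 1 \<Longrightarrow> \<delta> \<le> (\<Sum>k\<in>S. c k * (t ^ p k * (1 - t) ^ q k))"
  shows "\<delta> \<le> (\<Sum>k\<in>S. c k * (pochhammer a (p k) * pochhammer b (q k) / pochhammer (a + b) (p k + q k)))"
proof -
  define w where "w t = t powr (a - 1) * (1 - t) powr (b - 1)" for t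
  have B: "Beta a b > 0"
    using assms by (auto simp: Beta_def intro!: divide_pos_pos mult_pos_pos Gamma_real_pos)
  have "(w has_integral Beta a b) {0..1}"
    using has_integral_Beta_real[OF assms(1,2)] by (simp add: w_def [abs_def])
  hence 1: "((\<lambda>t. \<delta> * w t) has_integral \<delta> * Beta a b) {0..1}"
    by (rule has_integral_mult_right)
  have "((\<lambda>t. \<Sum>k\<in>S. c k * (t ^ p k * (1 - t) ^ q k * w t)) has_integral
     (\<Sum>k\<in>S. c k * (Beta a b * (pochhammer a (p k) * pochhammer b (q k) / pochhammer (a + b) (p k + q k))))) {0..1}"
    unfolding w_def using assms by (intro has_integral_sum has_integral_mult_right beta_moment) auto
  hence 2: "((\<lambda>t. (\<Sum>k\<in>S. c k * (t ^ p k * (1 - t) ^ q k)) * w t) has_integral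
     Beta a b * (\<Sum>k\<in>S. c k * ((pochhammer a (p k) * pochhammer b (q k) / pochhammer (a + b) (p k + q k))))) {0..1}"
    by (simp add: sum_distrib_left sum_distrib_right mult_ac)
  have "\<delta> * Beta a b \<le> Beta a b * (\<Sum>k\<in>S. c k * ((pochhammer a (p k) * pochhammer b (q k) / pochhammer (a + b) (p k + q k))))"
    by (rule has_integral_le[OF 1 2]) (intro mult_right_mono assms(4), auto simp: w_def)
  thus ?thesis using B by (simp add: mult.commute)
qed

lemma binomial_series_pochhammer:
  fixes \<gamma> z :: real
  assumes "\<bar>z\<bar> < 1"
  shows "(\<lambda>n. pochhammer \<gamma> n / fact n * z ^ n) sums (1 - z) powr (- \<gamma>)"
proof -
  have "((-\<gamma>) gchoose n) * (-z) ^ n = pochhammer \<gamma> n / fact n * z ^ n" for n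
    by (simp add: gbinomial_pochhammer power_minus[of z] mult_ac flip: power_add) 
  thus ?thesis using gen_binomial_real[of "-z" "-\<gamma>"] assms by simp
qed

lemma binomial_series_abs_summable:
  fixes \<gamma> z :: real
  assumes "\<bar>z\<bar> < 1"
  shows "summable (\<lambda>n. \<bar>pochhammer \<gamma> n / fact n * z ^ n\<bar>)"
proof -
  obtain y where y: "\<bar>z\<bar> < y" "y < 1" using assms dense by blast
  have "summable (\<lambda>n. pochhammer \<gamma> n / fact n * y ^ n)"
    using binomial_series_pochhammer[of y \<gamma>] y by (auto simp: sums_iff)
  from powser_insidea[OF this, of z] y show ?thesis by auto
qed

text \<open>The limit \<open>(1 - z) powr (- \<gamma>)\<close> has a positive minimum on the compact
  interval and the convergence there is uniform, so late partial sums stay above half of this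
  minimum. Uniformity in \<open>z\<close> permits averaging, and uniformity in \<open>K\<close> the
  passage to the limit.\<close>

lemma binomial_partial_sums_lower_bound:
  fixes \<gamma> \<rho> :: real
  assumes "0 \<le> \<rho>" "\<rho> < 1"
  obtains \<delta> K0 where "\<delta> > 0"
    "\<And>K z. K \<ge> K0 \<Longrightarrow> \<bar>z\<bar> \<le> \<rho> \<Longrightarrow> \<delta> \<le> (\<Sum>n<K. pochhammer \<gamma> n / fact n * z ^ n)"
proof -
  define f where "f z = (1 - z) powr (- \<gamma>)" for z :: real
  have "continuous_on {-\<rho>..\<rho>} f"
    unfolding f_def using assms by (intro continuous_intros) auto
  then obtain z0 where z0: "z0 \<in> {-\<rho>..\<rho>}" "\<And>z. z \<in> {-\<rho>..\<rho>} \<Longrightarrow> f z0 \<le> f z"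
    using continuous_attains_inf[of "{-\<rho>..\<rho>}" f] assms by auto
  have pos: "f z0 > 0" using z0(1) assms by (auto simp: f_def)
  have "uniform_limit {-\<rho>..\<rho>} (\<lambda>K z. \<Sum>n<K. pochhammer \<gamma> n / fact n * z ^ n)
          (\<lambda>z. \<Sum>n. pochhammer \<gamma> n / fact n * z ^ n) sequentially"
  proof (rule Weierstrass_m_test)
    show "summable (\<lambda>n. \<bar>pochhammer \<gamma> n / fact n * \<rho> ^ n\<bar>)"
      by (rule binomial_series_abs_summable) (use assms in auto)
    show "norm (pochhammer \<gamma> n / fact n * z ^ n) \<le> \<bar>pochhammer \<gamma> n / fact n * \<rho> ^ n\<bar>"
      if "z \<in> {-\<rho>..\<rho>}" for n z
      unfolding real_norm_def abs_mult using that assms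
      by (intro mult_left_mono) (auto simp: power_abs intro!: power_mono)
  qed
  from uniform_limitD[OF this, of "f z0 / 2"] pos
  have "eventually (\<lambda>K. \<forall>z\<in>{-\<rho>..\<rho>}. dist (\<Sum>n<K. pochhammer \<gamma> n / fact n * z ^ n)
      (\<Sum>n. pochhammer \<gamma> n / fact n * z ^ n) < f z0 / 2) sequentially"
    by linarith
  then obtain K0 where K0: "\<And>K z. K \<ge> K0 \<Longrightarrow> z \<in> {-\<rho>..\<rho>} \<Longrightarrow>
      dist (\<Sum>n<K. pochhammer \<gamma> n / fact n * z ^ n) (\<Sum>n. pochhammer \<gamma> n / fact n * z ^ n) < f z0 / 2"
    unfolding eventually_at_top_linorder by blast
  show ?thesis
  proof
    show "f z0 / 2 > 0" using pos by simp
    fix K z assume "K \<ge> K0" "\<bar>z\<bar> \<le> \<rho>"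
    hence z: "z \<in> {-\<rho>..\<rho>}" by auto
    have "(\<Sum>n. pochhammer \<gamma> n / fact n * z ^ n) = f z"
      unfolding f_def by (rule sums_unique[symmetric], rule binomial_series_pochhammer) (use z assms in auto)
    with K0[OF \<open>K \<ge> K0\<close> z] have "\<bar>(\<Sum>n<K. pochhammer \<gamma> n / fact n * z ^ n) - f z\<bar> < f z0 / 2"
      by (simp only: dist_real_def)
    with z0(2)[OF z] show "f z0 / 2 \<le> (\<Sum>n<K. pochhammer \<gamma> n / fact n * z ^ n)"
      by linarith
  qed
qed

text \<open>\<open>f_beta \<beta> x\<close> is the mean of
  \<open>(1 - x * T) powr (\<beta> - 1)\<close> for \<open>T\<close> with law
  Beta(\<open>\<beta>\<close>, \<open>\<beta>\<close>). The lower bound is averaged for partial sums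
  and survives the limit.\<close>

lemma f_beta_pos:
  assumes "\<beta> > 0" "0 \<le> x" "x < 1"
  shows "f_beta \<beta> x > 0"
proof -
  define t where "t n = pochhammer (1 - \<beta>) n / fact n * x ^ n * (pochhammer \<beta> n / pochhammer (2 * \<beta>) n)" for n
  obtain \<delta> K0 where \<delta>: "\<delta> > 0"
    "\<And>K z. K \<ge> K0 \<Longrightarrow> \<bar>z\<bar> \<le> x \<Longrightarrow> \<delta> \<le> (\<Sum>n<K. pochhammer (1 - \<beta>) n / fact n * z ^ n)"
    using binomial_partial_sums_lower_bound[OF assms(2,3)] by metis
  have ge: "\<delta> \<le> (\<Sum>n<K. t n)" if "K \<ge> K0" for K
  proof -
    have "\<delta> \<le> (\<Sum>n<K. pochhammer (1 - \<beta>) n / fact n * x ^ n *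
       (pochhammer \<beta> n * pochhammer \<beta> 0 / pochhammer (\<beta> + \<beta>) (n + 0)))"
    proof (rule beta_mean_lower_bound)
      fix s :: real assume "0 \<le> s" "s \<le> 1"
      hence "\<bar>x * s\<bar> \<le> x" using assms by (simp add: abs_mult mult_left_le)
      from \<delta>(2)[OF that this] 
      show "\<delta> \<le> (\<Sum>n<K. pochhammer (1 - \<beta>) n / fact n * x ^ n * (s ^ n * (1 - s) ^ 0))"
        by (simp add: power_mult_distrib mult_ac)
    qed (use assms in auto)
    thus ?thesis by (simp add: t_def)
  qed
  have "summable t"
  proof (rule summable_comparison_test)
    show "summable (\<lambda>n. \<bar>pochhammer (1 - \<beta>) n / fact n * x ^ n\<bar>)"
      by (rule binomial_series_abs_summable) (use assms in auto)
    have "norm (t n) \<le> \<bar>pochhammer (1 - \<beta>) n / fact n * x ^ n\<bar>" for n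
    proof -
      have "pochhammer \<beta> n \<le> pochhammer (2 * \<beta>) n"
        unfolding pochhammer_prod using assms by (intro prod_mono) auto
      moreover have "pochhammer \<beta> n > 0" using assms by (auto intro: pochhammer_pos)
      ultimately have "\<bar>pochhammer \<beta> n / pochhammer (2 * \<beta>) n\<bar> \<le> 1" by (auto simp: divide_simps)
      thus ?thesis unfolding t_def real_norm_def abs_mult
        by (intro mult_left_le) auto
    qed
    thus "\<exists>N. \<forall>n\<ge>N. norm (t n) \<le> \<bar>pochhammer (1 - \<beta>) n / fact n * x ^ n\<bar>" by blast
  qed
  hence "(\<lambda>K. \<Sum>n<K. t n) \<longlonglongrightarrow> suminf t" by (rule summable_LIMSEQ)
  hence "\<delta> \<le> suminf t"
    by (rule tendsto_lowerbound) (use ge in \<open>auto simp: eventually_at_top_linorder\<close>)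
  also have "suminf t = f_beta \<beta> x"
    unfolding f_beta_eq t_def by (simp only: times_divide_eq_left times_divide_eq_right divide_divide_eq_left mult_ac)
  finally show ?thesis using \<delta>(1) by simp
qed

section \<open>Double power series on the unit square\<close>

definition pser :: "(nat \<times> nat \<Rightarrow> real) \<Rightarrow> real \<times> real \<Rightarrow> real" where
  "pser C r = (\<Sum>\<^sub>\<infinity>n. C n * mpow r n)"

text \<open>A single radius serves both variables, because the two coordinates of a point of the
  open square lie below a common \<open>\<rho> < 1\<close> in modulus.\<close>

definition unit_conv :: "(nat \<times> nat \<Rightarrow> real) \<Rightarrow> bool" where
  "unit_conv C \<longleftrightarrow> (\<forall>\<rho>. 0 < \<rho> \<longrightarrow> \<rho> < 1 \<longrightarrow> (\<lambda>n. \<bar>C n\<bar> * \<rho> ^ (fst n + snd n)) summable_on UNIV)"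

abbreviation (input) unit_square :: "(real \<times> real) set" where
  "unit_square \<equiv> {-1<..<1} \<times> {-1<..<1}"

lemma abs_mpow_le:
  assumes "\<bar>fst r\<bar> \<le> \<rho>" "\<bar>snd r\<bar> \<le> \<rho>"
  shows "\<bar>mpow r n\<bar> \<le> \<rho> ^ (fst n + snd n)"
  unfolding mpow_def abs_mult power_abs power_add
  using assms by (intro mult_mono power_mono) auto

text \<open>\<open>Y\<close> is arbitrary so that one Weierstrass test serves small squares inside
  the open square, strips that reach the boundary, and the closed square.\<close>

lemma pser_mtest:
  assumes "M summable_on UNIV" "\<And>n r. r \<in> Y \<Longrightarrow> \<bar>C n * mpow r n\<bar> \<le> M n"
  shows "uniform_limit Y (\<lambda>N r. \<Sum>n\<in>N. C n * mpow r n) (pser C) (finite_subsets_at_top UNIV)"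
    and "continuous_on Y (pser C)"
    and "r \<in> Y \<Longrightarrow> (\<lambda>n. C n * mpow r n) summable_on UNIV"
proof -
  show 1: "uniform_limit Y (\<lambda>N r. \<Sum>n\<in>N. C n * mpow r n) (pser C) (finite_subsets_at_top UNIV)"
    unfolding pser_def using assms by (intro Weierstrass_m_test_general[where M = M]) auto
  show "continuous_on Y (pser C)"
    by (rule uniform_limit_theorem[OF _ 1])
      (auto simp: mpow_def intro!: always_eventually continuous_intros)
  show "(\<lambda>n. C n * mpow r n) summable_on UNIV" if "r \<in> Y"
    by (rule abs_summable_summable, rule Infinite_Sum.abs_summable_on_comparison_test'[OF assms(1)])
      (use assms(2)[OF that] in auto)
qed

lemma unit_square_radius:
  assumes "r \<in> unit_square"
  obtains \<rho> where "0 < \<rho>" "\<rho> < 1" "\<bar>fst r\<bar> < \<rho>" "\<bar>snd r\<bar> < \<rho>"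
proof -
  have "max \<bar>fst r\<bar> \<bar>snd r\<bar> < 1" using assms by auto
  then obtain \<rho> where "max \<bar>fst r\<bar> \<bar>snd r\<bar> < \<rho>" "\<rho> < 1" using dense by blast
  thus ?thesis using that[of \<rho>] by auto
qed

lemma unit_conv_bound:
  assumes "\<bar>fst r\<bar> \<le> \<rho>" "\<bar>snd r\<bar> \<le> \<rho>"
  shows "\<bar>C n * mpow r n\<bar> \<le> \<bar>C n\<bar> * \<rho> ^ (fst n + snd n)"
  using abs_mpow_le[OF assms, of n] by (simp add: abs_mult mult_left_mono)

lemma pser_summable:
  assumes "unit_conv C" "r \<in> unit_square"
  shows "(\<lambda>n. C n * mpow r n) summable_on UNIV"
proof -
  obtain \<rho> where \<rho>: "0 < \<rho>" "\<rho> < 1" "\<bar>fst r\<bar> < \<rho>" "\<bar>snd r\<bar> < \<rho>"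
    using unit_square_radius[OF assms(2)] .
  show ?thesis
  proof (rule pser_mtest(3)[where Y = "{r}"])
    show "(\<lambda>n. \<bar>C n\<bar> * \<rho> ^ (fst n + snd n)) summable_on UNIV"
      using assms(1) \<rho> by (auto simp: unit_conv_def)
    show "\<bar>C n * mpow s n\<bar> \<le> \<bar>C n\<bar> * \<rho> ^ (fst n + snd n)" if "s \<in> {r}" for n s
      using unit_conv_bound[of s \<rho> C n] \<rho> that by auto
  qed auto
qed

lemma pser_has_sum:
  assumes "unit_conv C" "r \<in> unit_square"
  shows "((\<lambda>n. C n * mpow r n) has_sum pser C r) UNIV"
  unfolding pser_def by (rule has_sum_infsum[OF pser_summable[OF assms]])

lemma pser_locally_uniformly:
  assumes "unit_conv C"
  shows "has_sum_locally_uniformly (\<lambda>n r. C n * mpow r n) (pser C) unit_square"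
  unfolding has_sum_locally_uniformly_def
proof
  fix x assume "x \<in> unit_square"
  then obtain \<rho> where \<rho>: "0 < \<rho>" "\<rho> < 1" "\<bar>fst x\<bar> < \<rho>" "\<bar>snd x\<bar> < \<rho>"
    using unit_square_radius by blast
  let ?U = "{-\<rho><..<\<rho>} \<times> {-\<rho><..<\<rho>}"
  have "uniform_limit (?U \<inter> unit_square) (\<lambda>N r. \<Sum>n\<in>N. C n * mpow r n) (pser C) (finite_subsets_at_top UNIV)"
  proof (rule pser_mtest(1))
    show "(\<lambda>n. \<bar>C n\<bar> * \<rho> ^ (fst n + snd n)) summable_on UNIV"
      using assms \<rho> by (auto simp: unit_conv_def)
    show "\<bar>C n * mpow r n\<bar> \<le> \<bar>C n\<bar> * \<rho> ^ (fst n + snd n)" if "r \<in> ?U \<inter> unit_square" for n r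
      using unit_conv_bound[of r \<rho> C n] that by auto
  qed
  moreover have "x \<in> ?U" using \<rho> by (cases x) auto
  moreover have "open ?U" by (intro open_Times open_greaterThanLessThan)
  ultimately show "\<exists>U. open U \<and> x \<in> U \<and>
      uniform_limit (U \<inter> unit_square) (\<lambda>N r. \<Sum>n\<in>N. C n * mpow r n) (pser C) (finite_subsets_at_top UNIV)"
    by blast
qed

lemma binomial_power_cbox_sum:
  fixes h p :: "real \<times> real"
  shows "(\<Sum>k\<in>{..fst n} \<times> {..snd n}.
       real (fst n choose fst k) * real (snd n choose snd k) * mpow p (n - k) * mpow h k) = mpow (h + p) n"
  (is "?L = ?R")
proof -
  have "?R = (\<Sum>i\<le>fst n. real (fst n choose i) * fst h ^ i * fst p ^ (fst n - i)) *
             (\<Sum>j\<le>snd n. real (snd n choose j) * snd h ^ j * snd p ^ (snd n - j))"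
    by (simp add: mpow_def binomial_ring)
  also have "\<dots> = ?L"
    unfolding sum_product sum.cartesian_product by (intro sum.cong) (auto simp: mpow_def)
  finally show ?thesis by simp
qed

text \<open>Put \<open>r = p + h\<close>, expand \<open>mpow (h + p) n\<close> by the binomial
  theorem in each coordinate and exchange the two summations. The result is a power series in
  \<open>h\<close> around \<open>p\<close>.\<close>

lemma pser_analytic:
  assumes "unit_conv C"
  shows "real_analytic2_on (pser C) unit_square"
  unfolding real_analytic2_on_def
proof
  fix p :: "real \<times> real" assume p: "p \<in> unit_square"
  define b where "b n k = real (fst n choose fst k) * real (snd n choose snd k)" for n k :: "nat \<times> nat"
  define c where "c k = (\<Sum>\<^sub>\<infinity>n. C n * (b n k * mpow p (n - k)))" for k
  \<comment> \<open>With this radius \<open>\<bar>p\<bar> + \<bar>h\<bar>\<close>, taken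
    coordinatewise, stays in the square, where the majorant converges.\<close>
  define \<rho> where "\<rho> = min (1 - \<bar>fst p\<bar>) (1 - \<bar>snd p\<bar>)"
  have "\<rho> > 0" using p by (auto simp: \<rho>_def)
  have "((\<lambda>n. c n * mpow (r - p) n) has_sum pser C r) UNIV"
    if r: "\<bar>fst r - fst p\<bar> < \<rho>" "\<bar>snd r - snd p\<bar> < \<rho>" for r
  proof -
    define h where "h = r - p"
    define abs2 where "abs2 q = (\<bar>fst q\<bar>, \<bar>snd q\<bar>)" for q :: "real \<times> real"
    have abs_mpow: "\<bar>mpow q n\<bar> = mpow (abs2 q) n" for q n
      by (simp add: mpow_def abs2_def abs_mult power_abs)
    have h: "\<bar>fst p\<bar> + \<bar>fst h\<bar> < 1" "\<bar>snd p\<bar> + \<bar>snd h\<bar> < 1"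
      using r by (auto simp: h_def \<rho>_def)
    hence r_in: "r \<in> unit_square" and s_in: "abs2 h + abs2 p \<in> unit_square"
      by (cases r; cases p; auto simp: h_def abs2_def)+
    define g where "g = (\<lambda>(n, k). C n * (b n k * mpow p (n - k)) * mpow h k)"
    \<comment> \<open>The binomial coefficients vanish unless \<open>k \<le> n\<close> in both
      coordinates, so the truncated subtraction \<open>n - k\<close> does no harm.\<close>
    have b0: "b n k = 0" if "k \<notin> {..fst n} \<times> {..snd n}" for n k
      using that by (cases k) (auto simp: b_def)
    have row: "((\<lambda>k. g (n, k)) has_sum C n * mpow r n) UNIV" for n
    proof (rule has_sum_finite_neutralI[of "{..fst n} \<times> {..snd n}"])
      show "C n * mpow r n = (\<Sum>k\<in>{..fst n} \<times> {..snd n}. g (n, k))"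
        using binomial_power_cbox_sum[of n p h]
        by (simp add: g_def b_def h_def mult.assoc flip: sum_distrib_left)
    qed (auto simp: g_def b0)
    \<comment> \<open>The expansion with moduli sums to the series of \<open>\<bar>C n\<bar>\<close>
      at \<open>abs2 h + abs2 p\<close>. This gives absolute summability over pairs, which justifies
      the exchange.\<close>
    have abs_row: "((\<lambda>k. \<bar>g (n, k)\<bar>) has_sum \<bar>C n\<bar> * mpow (abs2 h + abs2 p) n) UNIV" for n
    proof (rule has_sum_finite_neutralI[of "{..fst n} \<times> {..snd n}"])
      show "\<bar>C n\<bar> * mpow (abs2 h + abs2 p) n = (\<Sum>k\<in>{..fst n} \<times> {..snd n}. \<bar>g (n, k)\<bar>)"
        unfolding binomial_power_cbox_sum[of n "abs2 p" "abs2 h", symmetric] sum_distrib_left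
        by (intro sum.cong) (auto simp: g_def b_def abs_mult abs_mpow mult_ac)
    qed (auto simp: g_def b0)
    have "(\<lambda>x. \<bar>g x\<bar>) summable_on (UNIV \<times> UNIV)"
    proof (rule summable_on_SigmaI[OF abs_row])
      have "unit_conv (\<lambda>n. \<bar>C n\<bar>)" using assms by (simp add: unit_conv_def)
      from pser_summable[OF this s_in]
      show "(\<lambda>n. \<bar>C n\<bar> * mpow (abs2 h + abs2 p) n) summable_on UNIV" .
    qed auto
    hence g: "g summable_on (UNIV \<times> UNIV)"
      by (simp add: abs_summable_summable)
    have "(g has_sum pser C r) (UNIV \<times> UNIV)"
      by (rule has_sum_SigmaI[OF row pser_has_sum[OF assms r_in] g])
    hence sw: "((\<lambda>(k, n). g (n, k)) has_sum pser C r) (UNIV \<times> UNIV)"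
      by (rule has_sum_swap[THEN iffD1])
    have col: "((\<lambda>n. g (n, k)) has_sum c k * mpow h k) UNIV" for k
    proof -
      have "(\<lambda>n. g (n, k)) summable_on UNIV"
        using summable_on_SigmaD1[OF has_sum_imp_summable[OF sw]] by simp
      moreover have "(\<Sum>\<^sub>\<infinity>n. g (n, k)) = c k * mpow h k"
        unfolding g_def c_def prod.case by (rule infsum_cmult_left')
      ultimately show ?thesis by (simp add: has_sum_iff)
    qed
    show ?thesis
      using has_sum_SigmaD[OF sw, of "\<lambda>k. c k * mpow h k"] col by (simp add: h_def)
  qed
  with \<open>\<rho> > 0\<close> show "\<exists>c. \<exists>\<rho>>0. \<forall>r. \<bar>fst r - fst p\<bar> < \<rho> \<and> \<bar>snd r - snd p\<bar> < \<rho> \<longrightarrow>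
      ((\<lambda>n. c n * mpow (r - p) n) has_sum pser C r) UNIV"
    by blast
qed

section \<open>Termwise differentiation\<close>

definition deriv1 :: "(nat \<times> nat \<Rightarrow> real) \<Rightarrow> nat \<times> nat \<Rightarrow> real" where
  "deriv1 C = (\<lambda>(i, j). real (Suc i) * C (Suc i, j))"

lemma unit_conv_linear:
  assumes "unit_conv C" "unit_conv D"
  shows "unit_conv (\<lambda>n. a * C n + b * D n)"
  unfolding unit_conv_def
proof (intro allI impI)
  fix \<rho> :: real assume \<rho>: "0 < \<rho>" "\<rho> < 1"
  have "(\<lambda>n. \<bar>a\<bar> * (\<bar>C n\<bar> * \<rho> ^ (fst n + snd n)) + \<bar>b\<bar> * (\<bar>D n\<bar> * \<rho> ^ (fst n + snd n))) summable_on UNIV"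
    using assms \<rho> by (intro summable_on_add summable_on_cmult_right) (auto simp: unit_conv_def)
  thus "(\<lambda>n. \<bar>a * C n + b * D n\<bar> * \<rho> ^ (fst n + snd n)) summable_on UNIV"
  proof (rule summable_on_comparison_test)
    fix n
    have "\<bar>a * C n + b * D n\<bar> \<le> \<bar>a\<bar> * \<bar>C n\<bar> + \<bar>b\<bar> * \<bar>D n\<bar>"
      by (metis abs_mult abs_triangle_ineq)
    hence "\<bar>a * C n + b * D n\<bar> * \<rho> ^ (fst n + snd n) \<le> (\<bar>a\<bar> * \<bar>C n\<bar> + \<bar>b\<bar> * \<bar>D n\<bar>) * \<rho> ^ (fst n + snd n)"
      using \<rho> by (intro mult_right_mono) auto
    thus "\<bar>a * C n + b * D n\<bar> * \<rho> ^ (fst n + snd n)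
       \<le> \<bar>a\<bar> * (\<bar>C n\<bar> * \<rho> ^ (fst n + snd n)) + \<bar>b\<bar> * (\<bar>D n\<bar> * \<rho> ^ (fst n + snd n))"
      by (simp add: algebra_simps)
  qed (use \<rho> in auto)
qed

lemma unit_conv_swap:
  assumes "unit_conv C"
  shows "unit_conv (\<lambda>n. C (prod.swap n))"
  unfolding unit_conv_def
proof (intro allI impI)
  fix \<rho> :: real assume \<rho>: "0 < \<rho>" "\<rho> < 1"
  have "(\<lambda>n. (\<lambda>n. \<bar>C n\<bar> * \<rho> ^ (fst n + snd n)) (prod.swap n)) summable_on UNIV"
    using assms \<rho> by (subst summable_on_reindex_bij_betw) (auto simp: unit_conv_def)
  thus "(\<lambda>n. \<bar>C (prod.swap n)\<bar> * \<rho> ^ (fst n + snd n)) summable_on UNIV"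
    by (simp add: add.commute)
qed

text \<open>A factor \<open>fst n\<close> is paid for by a slightly larger radius: for
  \<open>\<rho> < \<sigma> < 1\<close> the numbers \<open>i * (\<rho> / \<sigma>) ^ i\<close> are
  bounded.\<close>

lemma unit_conv_times_index:
  assumes "unit_conv C"
  shows "unit_conv (\<lambda>n. real (fst n) * C n)"
  unfolding unit_conv_def
proof (intro allI impI)
  fix \<rho> :: real assume \<rho>: "0 < \<rho>" "\<rho> < 1"
  then obtain \<sigma> where \<sigma>: "\<rho> < \<sigma>" "\<sigma> < 1" using dense by blast
  have "(\<lambda>i. real i * (\<rho> / \<sigma>) ^ i) \<longlonglongrightarrow> 0"
    using \<rho> \<sigma> by (intro powser_times_n_limit_0) auto
  from convergent_imp_Bseq[OF convergentI[OF this]] obtain K where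
    K: "K > 0" "\<And>i. norm (real i * (\<rho> / \<sigma>) ^ i) \<le> K" by (rule BseqE) blast
  have "(\<lambda>n. K * (\<bar>C n\<bar> * \<sigma> ^ (fst n + snd n))) summable_on UNIV"
    using assms \<rho> \<sigma> by (intro summable_on_cmult_right) (auto simp: unit_conv_def)
  thus "(\<lambda>n. \<bar>real (fst n) * C n\<bar> * \<rho> ^ (fst n + snd n)) summable_on UNIV"
  proof (rule summable_on_comparison_test)
    fix n :: "nat \<times> nat"
    have "real (fst n) * \<rho> ^ fst n \<le> K * \<sigma> ^ fst n"
      using K(2)[of "fst n"] \<rho> \<sigma> by (simp add: power_divide field_simps)
    moreover have "\<rho> ^ snd n \<le> \<sigma> ^ snd n" using \<rho> \<sigma> by (intro power_mono) auto
    ultimately have "(real (fst n) * \<rho> ^ fst n) * \<rho> ^ snd n \<le> (K * \<sigma> ^ fst n) * \<sigma> ^ snd n"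
      by (rule mult_mono) (use \<rho> \<sigma> K(1) in auto)
    hence "\<bar>C n\<bar> * ((real (fst n) * \<rho> ^ fst n) * \<rho> ^ snd n) \<le> \<bar>C n\<bar> * ((K * \<sigma> ^ fst n) * \<sigma> ^ snd n)"
      by (rule mult_left_mono) auto
    thus "\<bar>real (fst n) * C n\<bar> * \<rho> ^ (fst n + snd n) \<le> K * (\<bar>C n\<bar> * \<sigma> ^ (fst n + snd n))"
      by (simp add: abs_mult power_add mult_ac)
  qed (use \<rho> in auto)
qed

lemma unit_conv_deriv1:
  assumes "unit_conv C"
  shows "unit_conv (deriv1 C)"
  unfolding unit_conv_def
proof (intro allI impI)
  fix \<rho> :: real assume \<rho>: "0 < \<rho>" "\<rho> < 1"
  let ?f = "\<lambda>n. \<bar>real (fst n) * C n\<bar> * \<rho> ^ (fst n + snd n)"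
  let ?s = "\<lambda>(i, j). (Suc i, j :: nat)"
  have "?f summable_on UNIV"
    using unit_conv_times_index[OF assms] \<rho> unfolding unit_conv_def by blast
  hence "?f summable_on range ?s" by (rule summable_on_subset_banach) auto
  hence "(?f \<circ> ?s) summable_on UNIV"
    by (subst (asm) summable_on_reindex) (auto simp: inj_on_def)
  hence "(\<lambda>n. (1 / \<rho>) * (?f \<circ> ?s) n) summable_on UNIV" by (rule summable_on_cmult_right)
  moreover have "(1 / \<rho>) * (?f \<circ> ?s) n = \<bar>deriv1 C n\<bar> * \<rho> ^ (fst n + snd n)" for n
    using \<rho> by (cases n) (simp add: deriv1_def)
  ultimately show "(\<lambda>n. \<bar>deriv1 C n\<bar> * \<rho> ^ (fst n + snd n)) summable_on UNIV"
    by simp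
qed

lemma pser_row:
  assumes "unit_conv C" "y \<in> {-1<..<1}"
  shows "((\<lambda>j. C (i, j) * y ^ j) has_sum (\<Sum>\<^sub>\<infinity>j. C (i, j) * y ^ j)) UNIV"
proof (rule has_sum_infsum)
  \<comment> \<open>Row \<open>i\<close> is read off from the double series at a point with nonzero
    first coordinate; multiplying by \<open>2 ^ i\<close> removes the power of
    \<open>1/2\<close>.\<close>
  have "(\<lambda>n. C n * mpow (1/2, y) n) summable_on UNIV \<times> UNIV"
    using pser_summable[OF assms(1), of "(1/2, y)"] assms(2) by simp
  hence "(\<lambda>(i, j). C (i, j) * mpow (1/2, y) (i, j)) summable_on UNIV \<times> UNIV"
    by (simp add: case_prod_unfold)
  from summable_on_SigmaD1[OF this, of i]
  have "(\<lambda>j. 2 ^ i * (C (i, j) * mpow (1/2, y) (i, j))) summable_on UNIV"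
    by (intro summable_on_cmult_right) auto
  thus "(\<lambda>j. C (i, j) * y ^ j) summable_on UNIV"
    by (simp add: mpow_def field_simps)
qed

lemma pser_iterated:
  assumes "unit_conv C" "(x, y) \<in> unit_square"
  shows "(\<lambda>i. (\<Sum>\<^sub>\<infinity>j. C (i, j) * y ^ j) * x ^ i) sums pser C (x, y)"
proof (rule has_sum_imp_sums, rule has_sum_SigmaD)
  show "((\<lambda>n. C n * mpow (x, y) n) has_sum pser C (x, y)) (UNIV \<times> UNIV)"
    using pser_has_sum[OF assms] by simp
  show "((\<lambda>j. C (i, j) * mpow (x, y) (i, j)) has_sum (\<Sum>\<^sub>\<infinity>j. C (i, j) * y ^ j) * x ^ i) UNIV" for i
    using has_sum_cmult_left[OF pser_row[OF assms(1), of y i], of "x ^ i"] assms(2)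
    by (simp add: mpow_def mult_ac)
qed

text \<open>For fixed \<open>y\<close> this is a power series in one variable whose coefficients are
  the row sums. Its formal derivative \<open>diffs\<close> has the row sums of
  \<open>deriv1 C\<close> as coefficients.\<close>

lemma pser_has_derivative1:
  assumes "unit_conv C" "(x, y) \<in> unit_square"
  shows "((\<lambda>t. pser C (t, y)) has_real_derivative pser (deriv1 C) (x, y)) (at x)"
proof -
  define c where "c i = (\<Sum>\<^sub>\<infinity>j. C (i, j) * y ^ j)" for i
  have y: "y \<in> {-1<..<1}" using assms by auto
  have sums: "(\<lambda>i. c i * t ^ i) sums pser C (t, y)" if "norm t < 1" for t
    unfolding c_def by (rule pser_iterated) (use that assms in auto)
  have diffs: "diffs c i = (\<Sum>\<^sub>\<infinity>j. deriv1 C (i, j) * y ^ j)" for i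
    unfolding diffs_def c_def deriv1_def prod.case
    by (simp only: infsum_cmult_right'[symmetric] mult.assoc)
  have "((\<lambda>t. \<Sum>i. c i * t ^ i) has_real_derivative (\<Sum>i. diffs c i * x ^ i)) (at x)"
    using sums assms by (intro termdiffs_strong'[of 1]) (auto simp: sums_iff)
  also have "(\<Sum>i. diffs c i * x ^ i) = pser (deriv1 C) (x, y)"
    using pser_iterated[OF unit_conv_deriv1[OF assms(1)] assms(2)] by (simp add: diffs sums_iff)
  finally show ?thesis
  proof (rule has_field_derivative_transform_within_open)
    show "open {-1<..<1::real}" "x \<in> {-1<..<1}" using assms by auto
    show "(\<Sum>i. c i * t ^ i) = pser C (t, y)" if "t \<in> {-1<..<1}" for t
      using sums[of t] that by (auto simp: sums_iff)
  qed
qed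

lemma pd1_pser:
  assumes "unit_conv C" "r \<in> unit_square"
  shows "pd1 (pser C) r = pser (deriv1 C) r"
  using DERIV_imp_deriv[OF pser_has_derivative1] assms by (cases r) (auto simp: pd1_def)

text \<open>A derivative depends only on values near the point. This is needed for second
  derivatives, because \<open>pd1 (pser C)\<close> is identified with a series on the open square
  only.\<close>

lemma pd1_cong:
  assumes "\<And>r. r \<in> unit_square \<Longrightarrow> f r = g r" "r \<in> unit_square"
  shows "pd1 f r = pd1 g r"
proof -
  obtain x y where r: "r = (x, y)" by fastforce
  have "eventually (\<lambda>t. t \<in> {-1<..<1}) (nhds x)"
    using assms(2) r by (intro eventually_nhds_in_open) auto
  hence "eventually (\<lambda>t. f (t, y) = g (t, y)) (nhds x)"
    by eventually_elim (use assms r in auto)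
  thus ?thesis unfolding r pd1_def prod.case by (intro deriv_cong_ev) auto
qed

lemma pd1_pd1_pser:
  assumes "unit_conv C" "r \<in> unit_square"
  shows "pd1 (pd1 (pser C)) r = pser (deriv1 (deriv1 C)) r"
  using pd1_cong[OF pd1_pser[OF assms(1)] assms(2)] pd1_pser[OF unit_conv_deriv1[OF assms(1)] assms(2)]
  by simp

lemma pser_swap: "pser C (prod.swap r) = pser (\<lambda>n. C (prod.swap n)) r"
proof -
  have "pser C (prod.swap r) = (\<Sum>\<^sub>\<infinity>n. (\<lambda>n. C n * mpow (prod.swap r) n) (prod.swap n))"
    unfolding pser_def by (rule infsum_reindex_bij_betw[symmetric]) auto
  thus ?thesis by (simp add: pser_def mpow_def mult_ac)
qed

text \<open>Derivatives in the second variable are reduced to those in the first by reflection, so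
  termwise differentiation is proved once.\<close>

lemma pd2_swap: "pd2 f r = pd1 (\<lambda>s. f (prod.swap s)) (prod.swap r)"
  by (cases r) (simp add: pd1_def pd2_def)

section \<open>Multiplication of a double series by a variable\<close>

definition shift1 :: "(nat \<times> nat \<Rightarrow> real) \<Rightarrow> nat \<times> nat \<Rightarrow> real" where
  "shift1 C = (\<lambda>(i, j). if i = 0 then 0 else C (i - 1, j))"

definition shift2 :: "(nat \<times> nat \<Rightarrow> real) \<Rightarrow> nat \<times> nat \<Rightarrow> real" where
  "shift2 C = (\<lambda>(i, j). if j = 0 then 0 else C (i, j - 1))"

lemma has_sum_shift1:
  assumes "((\<lambda>n. C n * mpow r n) has_sum s) UNIV"
  shows "((\<lambda>n. shift1 C n * mpow r n) has_sum fst r * s) UNIV"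
proof -
  let ?s = "\<lambda>(i, j). (Suc i, j :: nat)"
  let ?f = "\<lambda>n. shift1 C n * mpow r n"
  have "((\<lambda>n. fst r * (C n * mpow r n)) has_sum fst r * s) UNIV"
    by (rule has_sum_cmult_right[OF assms])
  also have "(\<lambda>n. fst r * (C n * mpow r n)) = ?f \<circ> ?s"
    by (auto simp: shift1_def mpow_def mult_ac)
  finally have "(?f has_sum fst r * s) (range ?s)"
    by (subst has_sum_reindex) (auto simp: inj_on_def o_def)
  moreover have "shift1 C n = 0" if "n \<notin> range ?s" for n
  proof (cases n)
    case (Pair i j)
    with that show ?thesis by (cases i) (auto simp: shift1_def image_iff)
  qed
  ultimately show ?thesis
    by (subst has_sum_cong_neutral[where T = "range ?s" and g = ?f]) auto
qed

lemma has_sum_shift2: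
  assumes "((\<lambda>n. C n * mpow r n) has_sum s) UNIV"
  shows "((\<lambda>n. shift2 C n * mpow r n) has_sum snd r * s) UNIV"
proof -
  let ?s = "\<lambda>(i :: nat, j). (i, Suc j)"
  let ?f = "\<lambda>n. shift2 C n * mpow r n"
  have "((\<lambda>n. snd r * (C n * mpow r n)) has_sum snd r * s) UNIV"
    by (rule has_sum_cmult_right[OF assms])
  also have "(\<lambda>n. snd r * (C n * mpow r n)) = ?f \<circ> ?s"
    by (auto simp: shift2_def mpow_def mult_ac)
  finally have "(?f has_sum snd r * s) (range ?s)"
    by (subst has_sum_reindex) (auto simp: inj_on_def o_def)
  moreover have "shift2 C n = 0" if "n \<notin> range ?s" for n
  proof (cases n)
    case (Pair i j)
    with that show ?thesis by (cases j) (auto simp: shift2_def image_iff)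
  qed
  ultimately show ?thesis
    by (subst has_sum_cong_neutral[where T = "range ?s" and g = ?f]) auto
qed

section \<open>The differential equations\<close>

lemma A0_swap: "A0 \<beta> (prod.swap n) = A0 \<beta> n"
  by (cases n) (simp add: A0_def mult_ac add.commute)

text \<open>The coefficient splits into two quotients by factorials, of exponent
  \<open>\<beta> - 1\<close> each, and the quotient at \<open>i + j\<close>, of exponent
  \<open>(1 - \<beta>) - 3 * \<beta>\<close>.\<close>

lemma A0_bound:
  assumes "\<beta> > 0"
  obtains C where "C > 0"
    "\<And>i j. \<bar>A0 \<beta> (i, j)\<bar> \<le> C * ((real i + 1) powr (\<beta> - 1) * (real j + 1) powr (\<beta> - 1) *
        (real i + real j + 1) powr (1 - 4 * \<beta>))"
proof -
  obtain C where C: "C > 0" "\<And>n. \<bar>pochhammer \<beta> n\<bar> \<le> C * (fact n * (real n + 1) powr (\<beta> - 1))"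
    using pochhammer_upper_bound by blast
  obtain D where D: "D > 0"
    "\<And>n. \<bar>pochhammer (1 - \<beta>) n / pochhammer (3 * \<beta>) n\<bar> \<le> D * (real n + 1) powr (1 - \<beta> - 3 * \<beta>)"
    using pochhammer_ratio_bound[of "3 * \<beta>" "1 - \<beta>"] assms by auto
  have C': "\<bar>pochhammer \<beta> n / fact n\<bar> \<le> C * (real n + 1) powr (\<beta> - 1)" for n
    using C(2)[of n] by (simp add: field_simps)
  show ?thesis
  proof
    show "C * C * D > 0" using C D by simp
    fix i j
    have "\<bar>A0 \<beta> (i, j)\<bar> = \<bar>pochhammer \<beta> i / fact i\<bar> * \<bar>pochhammer \<beta> j / fact j\<bar> *
        \<bar>pochhammer (1 - \<beta>) (i + j) / pochhammer (3 * \<beta>) (i + j)\<bar>"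
      by (simp add: A0_def abs_mult pochhammer_fact[symmetric])
    also have "\<dots> \<le> (C * (real i + 1) powr (\<beta> - 1)) * (C * (real j + 1) powr (\<beta> - 1)) *
        (D * (real (i + j) + 1) powr (1 - \<beta> - 3 * \<beta>))"
      using C(1) by (intro mult_mono C' D(2)) auto
    finally show "\<bar>A0 \<beta> (i, j)\<bar> \<le> C * C * D * ((real i + 1) powr (\<beta> - 1) * (real j + 1) powr (\<beta> - 1) *
        (real i + real j + 1) powr (1 - 4 * \<beta>))"
      by (simp add: mult_ac)
  qed
qed

text \<open>Comparison with the binomial series of \<open>(1 - x) powr (- (a + 1))\<close>, whose
  coefficients have the same growth; \<open>a > -1\<close> makes them positive.\<close>

lemma summable_powr_times_power:
  assumes "0 \<le> x" "x < 1" "a > -1"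
  shows "summable (\<lambda>n. (real n + 1) powr a * x ^ n)"
proof -
  obtain D where D: "D > 0" "\<And>n. fact n * (real n + 1) powr (a + 1 - 1) \<le> D * pochhammer (a + 1) n"
    using pochhammer_lower_bound[of "a + 1"] assms by auto
  have "summable (\<lambda>n. D * \<bar>pochhammer (a + 1) n / fact n * x ^ n\<bar>)"
    using assms by (intro summable_mult binomial_series_abs_summable) auto
  moreover have "norm ((real n + 1) powr a * x ^ n) \<le> D * \<bar>pochhammer (a + 1) n / fact n * x ^ n\<bar>" for n
  proof -
    have "(real n + 1) powr a \<le> D * \<bar>pochhammer (a + 1) n / fact n\<bar>"
      using D(2)[of n] pochhammer_pos[of "a + 1" n] assms by (simp add: field_simps)
    from mult_right_mono[OF this, of "x ^ n"] show ?thesis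
      using assms by (simp add: abs_mult mult_ac)
  qed
  ultimately show ?thesis
    by (rule summable_comparison_test'[where N = 0])
qed

lemma summable_on_product:
  fixes u v :: "nat \<Rightarrow> real"
  assumes "summable u" "summable v" "\<And>n. u n \<ge> 0" "\<And>n. v n \<ge> 0"
  shows "(\<lambda>n. u (fst n) * v (snd n)) summable_on UNIV"
proof -
  have v: "(v has_sum suminf v) UNIV"
    using assms by (intro norm_summable_imp_has_sum) (auto simp: summable_sums)
  have u: "u summable_on UNIV"
    using assms by (intro norm_summable_imp_summable_on) auto
  have "(\<lambda>n. u (fst n) * v (snd n)) summable_on (UNIV \<times> UNIV)"
  proof (rule summable_on_SigmaI)
    show "((\<lambda>j. u (fst (i, j)) * v (snd (i, j))) has_sum u i * suminf v) UNIV" for i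
      using has_sum_cmult_right[OF v] by simp
    show "(\<lambda>i. u i * suminf v) summable_on UNIV"
      by (intro summable_on_cmult_left u)
  qed (use assms in auto)
  thus ?thesis by simp
qed

lemma unit_conv_A0:
  assumes "\<beta> > 0"
  shows "unit_conv (A0 \<beta>)"
  unfolding unit_conv_def
proof (intro allI impI)
  fix \<rho> :: real assume \<rho>: "0 < \<rho>" "\<rho> < 1"
  obtain C where C: "C > 0"
    "\<And>i j. \<bar>A0 \<beta> (i, j)\<bar> \<le> C * ((real i + 1) powr (\<beta> - 1) * (real j + 1) powr (\<beta> - 1) *
        (real i + real j + 1) powr (1 - 4 * \<beta>))"
    using A0_bound[OF assms] by blast
  define u where "u n = (real n + 1) powr \<beta> * \<rho> ^ n" for n
  \<comment> \<open>A crude bound suffices inside the square: \<open>1 - 4 * \<beta> \<le> 1\<close>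
    and \<open>i + j + 1 \<le> (i + 1) * (j + 1)\<close>. The powers of \<open>\<rho>\<close> absorb
    the resulting growth.\<close>
  have bd: "\<bar>A0 \<beta> (i, j)\<bar> \<le> C * ((real i + 1) powr \<beta> * (real j + 1) powr \<beta>)" for i j
  proof -
    have "(real i + real j + 1) powr (1 - 4 * \<beta>) \<le> (real i + real j + 1) powr 1"
      using assms by (intro powr_mono) auto
    also have "\<dots> \<le> (real i + 1) powr 1 * (real j + 1) powr 1"
      by (simp add: algebra_simps)
    finally have "(real i + 1) powr (\<beta> - 1) * (real j + 1) powr (\<beta> - 1) * (real i + real j + 1) powr (1 - 4 * \<beta>)
      \<le> (real i + 1) powr (\<beta> - 1) * (real j + 1) powr (\<beta> - 1) * ((real i + 1) powr 1 * (real j + 1) powr 1)"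
      by (intro mult_left_mono) auto
    also have "\<dots> = ((real i + 1) powr (\<beta> - 1) * (real i + 1) powr 1) * ((real j + 1) powr (\<beta> - 1) * (real j + 1) powr 1)"
      by (simp only: mult_ac)
    also have "\<dots> = (real i + 1) powr \<beta> * (real j + 1) powr \<beta>"
      unfolding powr_add[symmetric] by simp
    finally show ?thesis
      using C(1) by (intro order.trans[OF C(2)] mult_left_mono) auto
  qed
  have "(\<lambda>n. C * (u (fst n) * u (snd n))) summable_on UNIV"
    unfolding u_def using \<rho> assms
    by (intro summable_on_cmult_right summable_on_product summable_powr_times_power) auto
  thus "(\<lambda>n. \<bar>A0 \<beta> n\<bar> * \<rho> ^ (fst n + snd n)) summable_on UNIV"
  proof (rule summable_on_comparison_test)
    fix n :: "nat \<times> nat"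
    show "\<bar>A0 \<beta> n\<bar> * \<rho> ^ (fst n + snd n) \<le> C * (u (fst n) * u (snd n))"
      using mult_right_mono[OF bd[of "fst n" "snd n"], of "\<rho> ^ (fst n + snd n)"] \<rho>
      by (simp add: u_def power_add mult_ac)
  qed (use \<rho> in auto)
qed

text \<open>The ratio of neighbouring coefficients. Its last factor depends on \<open>i + j\<close>
  only, which is what ties the two variables together in the differential equations.\<close>

lemma deriv1_A0:
  assumes "\<beta> > 0"
  shows "deriv1 (A0 \<beta>) (i, j) = A0 \<beta> (i, j) * (\<beta> + i) * ((1 - \<beta> + (i + j)) / (3 * \<beta> + (i + j)))"
proof -
  have "pochhammer (3 * \<beta>) (i + j) > 0" using assms by (intro pochhammer_pos) auto
  moreover have "3 * \<beta> + (real i + real j) > 0" using assms by simp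
  ultimately show ?thesis
    by (simp add: deriv1_def A0_def pochhammer_rec' divide_simps)
qed

text \<open>By the symmetry of \<open>A0\<close> this says that \<open>G0\<close> is
  \<open>- (\<beta> + r1 * \<partial>1)\<close> applied to the derivative of \<open>F0\<close> in
  \<open>r2\<close>. It reduces the convergence of the \<open>B0\<close> series to that of
  \<open>A0\<close>.\<close>

lemma B0_eq_deriv1_A0:
  assumes "\<beta> > 0"
  shows "B0 \<beta> (i, j) = - ((\<beta> + i) * deriv1 (A0 \<beta>) (j, i))"
  unfolding deriv1_A0[OF assms]
  by (simp add: B0_def A0_def pochhammer_rec' add.commute mult_ac)

lemma B0_swap: "B0 \<beta> (prod.swap n) = B0 \<beta> n"
  by (cases n) (simp add: B0_def mult_ac add.commute)

lemma unit_conv_B0: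
  assumes "\<beta> > 0"
  shows "unit_conv (B0 \<beta>)"
proof -
  define T where "T n = deriv1 (A0 \<beta>) (prod.swap n)" for n
  have T: "unit_conv T"
    unfolding T_def [abs_def] by (intro unit_conv_swap unit_conv_deriv1 unit_conv_A0 assms)
  have "B0 \<beta> = (\<lambda>n. (- \<beta>) * T n + (- 1) * (real (fst n) * T n))"
    using B0_eq_deriv1_A0[OF assms] by (auto simp: T_def algebra_simps)
  thus ?thesis using unit_conv_linear[OF T unit_conv_times_index[OF T], of "- \<beta>" "- 1"] by simp
qed

lemma F0_eq_pser: "F0 \<beta> = pser (A0 \<beta>)" and G0_eq_pser: "G0 \<beta> = pser (B0 \<beta>)"
  by (auto simp: F0_def G0_def pser_def)

lemma F0_swap: "F0 \<beta> (y, x) = F0 \<beta> (x, y)"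
  using pser_swap[of "A0 \<beta>" "(x, y)"] by (simp add: F0_eq_pser A0_swap)

lemma G0_swap: "G0 \<beta> (y, x) = G0 \<beta> (x, y)"
  using pser_swap[of "B0 \<beta>" "(x, y)"] by (simp add: G0_eq_pser B0_swap)

text \<open>Multiplication by \<open>r2\<close> undoes the index shift in \<open>B0\<close>, leaving
  a polynomial multiple of \<open>A0\<close>. In the difference with \<open>shift1_B0\<close> the
  terms \<open>i * j\<close> cancel and \<open>\<beta> * (i - j)\<close> remains, which is the
  first-order equation.\<close>

lemma shift2_B0:
  assumes "\<beta> > 0"
  shows "shift2 (B0 \<beta>) (i, j) = - ((\<beta> + i) * j * A0 \<beta> (i, j))"
  using A0_swap[of \<beta> "(i, j)"]
  by (cases j) (simp_all add: shift2_def B0_eq_deriv1_A0[OF assms] deriv1_def)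

lemma shift1_B0:
  assumes "\<beta> > 0"
  shows "shift1 (B0 \<beta>) (i, j) = - ((\<beta> + j) * i * A0 \<beta> (i, j))"
  using shift2_B0[OF assms, of j i] B0_swap[of \<beta> "(i - 1, j)"] A0_swap[of \<beta> "(i, j)"]
  by (simp add: shift1_def shift2_def split: if_splits)

lemma shift1_deriv1: "shift1 (deriv1 C) (i, j) = i * C (i, j)"
  by (cases i) (auto simp: shift1_def deriv1_def)

lemma shift1_shift1_deriv1_deriv1: "shift1 (shift1 (deriv1 (deriv1 C))) (i, j) = real i * (real i - 1) * C (i, j)"
proof (cases i)
  case (Suc k)
  have "shift1 (shift1 (deriv1 (deriv1 C))) (i, j) = shift1 (deriv1 (deriv1 C)) (k, j)" by (simp add: Suc shift1_def)
  also have "\<dots> = real i * (real i - 1) * C (i, j)" unfolding shift1_deriv1 by (simp add: deriv1_def Suc)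
  finally show ?thesis .
qed (simp add: shift1_def)

text \<open>Both sides are written as double series and compared coefficientwise.\<close>

lemma F0_pde:
  assumes "\<beta> > 0" "(x, y) \<in> unit_square"
  shows "x * (1 - x) * pd1 (pd1 (F0 \<beta>)) (x, y) + (2 * \<beta> - 2 * x) * pd1 (F0 \<beta>) (x, y)
             - \<beta> * (1 - \<beta>) * F0 \<beta> (x, y) = (1 - y) * G0 \<beta> (x, y)"
proof -
  let ?r = "(x, y)"
  let ?A = "A0 \<beta>" and ?B = "B0 \<beta>"
  note A = unit_conv_A0[OF assms(1)] and B = unit_conv_B0[OF assms(1)]
  note hA = pser_has_sum[OF A assms(2)] and hB = pser_has_sum[OF B assms(2)]
    and hD = pser_has_sum[OF unit_conv_deriv1[OF A] assms(2)]
    and hDD = pser_has_sum[OF unit_conv_deriv1[OF unit_conv_deriv1[OF A]] assms(2)]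
  have "((\<lambda>n. shift1 (deriv1 (deriv1 ?A)) n * mpow ?r n + (-1) * (shift1 (shift1 (deriv1 (deriv1 ?A))) n * mpow ?r n)
        + 2 * \<beta> * (deriv1 ?A n * mpow ?r n) + (-2) * (shift1 (deriv1 ?A) n * mpow ?r n)
        + (- (\<beta> * (1 - \<beta>))) * (?A n * mpow ?r n)) has_sum
      (fst ?r * pser (deriv1 (deriv1 ?A)) ?r + (-1) * (fst ?r * (fst ?r * pser (deriv1 (deriv1 ?A)) ?r))
        + 2 * \<beta> * pser (deriv1 ?A) ?r + (-2) * (fst ?r * pser (deriv1 ?A) ?r)
        + (- (\<beta> * (1 - \<beta>))) * pser ?A ?r)) UNIV"
    by (intro has_sum_add has_sum_cmult_right has_sum_shift1 hA hD hDD)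
  note sum1 = this
  have "((\<lambda>n. ?B n * mpow ?r n + (-1) * (shift2 ?B n * mpow ?r n)) has_sum
      (pser ?B ?r + (-1) * (snd ?r * pser ?B ?r))) UNIV"
    by (intro has_sum_add has_sum_cmult_right has_sum_shift2 hB)
  note sum2 = this
  have coeff: "shift1 (deriv1 (deriv1 ?A)) n * mpow ?r n + (-1) * (shift1 (shift1 (deriv1 (deriv1 ?A))) n * mpow ?r n)
        + 2 * \<beta> * (deriv1 ?A n * mpow ?r n) + (-2) * (shift1 (deriv1 ?A) n * mpow ?r n)
        + (- (\<beta> * (1 - \<beta>))) * (?A n * mpow ?r n)
      = ?B n * mpow ?r n + (-1) * (shift2 ?B n * mpow ?r n)" for n
  proof -
    obtain i j where n: "n = (i, j)" by fastforce
    define a q where "a = ?A (i, j)" and "q = (1 - \<beta> + (real i + real j)) / (3 * \<beta> + (real i + real j))"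
    have "3 * \<beta> + (real i + real j) > 0" using assms by simp
    hence q: "1 - \<beta> + (real i + real j) = q * (3 * \<beta> + (real i + real j))" by (simp add: q_def)
    have D: "deriv1 ?A (i, j) = a * (\<beta> + i) * q"
      using deriv1_A0[OF assms(1), of i j] by (simp add: a_def q_def)
    have B': "?B (i, j) = - ((\<beta> + i) * (a * (\<beta> + j) * q))"
      using B0_eq_deriv1_A0[OF assms(1), of i j] deriv1_A0[OF assms(1), of j i] A0_swap[of \<beta> "(i, j)"]
      by (simp add: a_def q_def add.commute)
    \<comment> \<open>Collected on one side, the terms with \<open>q\<close> give
      \<open>(\<beta> + i) * (3 * \<beta> + i + j) * q * a\<close>. By the choice of
      \<open>q\<close> this is \<open>(\<beta> + i) * (1 - \<beta> + i + j) * a\<close>, the sum of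
      the remaining terms.\<close>
    have "real i * (a * (\<beta> + i) * q) - real i * (real i - 1) * a + 2 * \<beta> * (a * (\<beta> + i) * q)
        - 2 * (real i * a) - \<beta> * (1 - \<beta>) * a = - ((\<beta> + i) * (a * (\<beta> + j) * q)) + (\<beta> + i) * j * a"
      using q by algebra
    hence eq: "shift1 (deriv1 (deriv1 ?A)) n - shift1 (shift1 (deriv1 (deriv1 ?A))) n + 2 * \<beta> * deriv1 ?A n - 2 * shift1 (deriv1 ?A) n
       - \<beta> * (1 - \<beta>) * ?A n = ?B n - shift2 ?B n"
      unfolding n shift1_shift1_deriv1_deriv1 shift1_deriv1 shift2_B0[OF assms(1)] D B' by (simp add: a_def)
    show ?thesis using eq by algebra
  qed
  have "fst ?r * pser (deriv1 (deriv1 ?A)) ?r + (-1) * (fst ?r * (fst ?r * pser (deriv1 (deriv1 ?A)) ?r))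
        + 2 * \<beta> * pser (deriv1 ?A) ?r + (-2) * (fst ?r * pser (deriv1 ?A) ?r)
        + (- (\<beta> * (1 - \<beta>))) * pser ?A ?r = pser ?B ?r + (-1) * (snd ?r * pser ?B ?r)"
    by (rule has_sum_unique[OF sum1[unfolded coeff] sum2])
  thus ?thesis
    unfolding F0_eq_pser G0_eq_pser pd1_pd1_pser[OF A assms(2)] pd1_pser[OF A assms(2)]
    by (simp add: algebra_simps)
qed

lemma F0_pde_first_order:
  assumes "\<beta> > 0" "(x, y) \<in> unit_square"
  shows "\<beta> * x * pd1 (F0 \<beta>) (x, y) - \<beta> * y * pd1 (F0 \<beta>) (y, x) = - (x - y) * G0 \<beta> (x, y)"
proof -
  let ?r = "(x, y)"
  let ?A = "A0 \<beta>" and ?B = "B0 \<beta>"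
  \<comment> \<open>By symmetry these are the coefficients of the derivative of \<open>F0\<close> in
    the second variable.\<close>
  define T where "T = (\<lambda>n. deriv1 ?A (prod.swap n))"
  note A = unit_conv_A0[OF assms(1)] and B = unit_conv_B0[OF assms(1)]
  have T: "unit_conv T" unfolding T_def by (intro unit_conv_swap unit_conv_deriv1 A)
  note hB = pser_has_sum[OF B assms(2)] and hD = pser_has_sum[OF unit_conv_deriv1[OF A] assms(2)]
    and hT = pser_has_sum[OF T assms(2)]
  have "((\<lambda>n. \<beta> * (shift1 (deriv1 ?A) n * mpow ?r n) + (- \<beta>) * (shift2 T n * mpow ?r n)) has_sum
      (\<beta> * (fst ?r * pser (deriv1 ?A) ?r) + (- \<beta>) * (snd ?r * pser T ?r))) UNIV"
    by (intro has_sum_add has_sum_cmult_right has_sum_shift1 has_sum_shift2 hD hT)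
  note sum1 = this
  have "((\<lambda>n. shift2 ?B n * mpow ?r n + (-1) * (shift1 ?B n * mpow ?r n)) has_sum
      (snd ?r * pser ?B ?r + (-1) * (fst ?r * pser ?B ?r))) UNIV"
    by (intro has_sum_add has_sum_cmult_right has_sum_shift1 has_sum_shift2 hB)
  note sum2 = this
  have coeff: "\<beta> * (shift1 (deriv1 ?A) n * mpow ?r n) + (- \<beta>) * (shift2 T n * mpow ?r n)
      = shift2 ?B n * mpow ?r n + (-1) * (shift1 ?B n * mpow ?r n)" for n
  proof -
    obtain i j where n: "n = (i, j)" by fastforce
    have "shift2 T (i, j) = shift1 (deriv1 ?A) (j, i)" by (simp add: shift1_def shift2_def T_def)
    hence "shift2 T (i, j) = j * ?A (i, j)" using A0_swap[of \<beta> "(i, j)"] by (simp add: shift1_deriv1)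
    thus ?thesis
      unfolding n shift1_deriv1 shift1_B0[OF assms(1)] shift2_B0[OF assms(1)] by (simp add: algebra_simps)
  qed
  have "\<beta> * (fst ?r * pser (deriv1 ?A) ?r) + (- \<beta>) * (snd ?r * pser T ?r)
     = snd ?r * pser ?B ?r + (-1) * (fst ?r * pser ?B ?r)"
    by (rule has_sum_unique[OF sum1[unfolded coeff] sum2])
  moreover have "pser T (x, y) = pd1 (F0 \<beta>) (y, x)"
    using pser_swap[of "deriv1 ?A" "(x, y)"] pd1_pser[OF A, of "(y, x)"] assms(2)
    by (simp add: T_def F0_eq_pser)
  ultimately show ?thesis
    unfolding F0_eq_pser G0_eq_pser pd1_pser[OF A assms(2)]
    by (simp add: algebra_simps)
qed

lemma pd2_F0:
  "pd2 (F0 \<beta>) (x, y) = pd1 (F0 \<beta>) (y, x)" "pd2 (pd2 (F0 \<beta>)) (x, y) = pd1 (pd1 (F0 \<beta>)) (y, x)"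
proof -
  show 1: "pd2 (F0 \<beta>) (x, y) = pd1 (F0 \<beta>) (y, x)" for x y
  proof -
    have "(\<lambda>t. F0 \<beta> (x, t)) = (\<lambda>t. F0 \<beta> (t, x))" by (rule ext, rule F0_swap)
    thus ?thesis by (simp only: pd1_def pd2_def prod.case)
  qed
  have "(\<lambda>s. pd2 (F0 \<beta>) (prod.swap s)) = pd1 (F0 \<beta>)"
    by (rule ext) (simp add: prod.swap_def 1)
  thus "pd2 (pd2 (F0 \<beta>)) (x, y) = pd1 (pd1 (F0 \<beta>)) (y, x)"
    by (subst pd2_swap) simp
qed

section \<open>Positivity and boundary values\<close>

text \<open>The series is grouped by total degree, since the positivity argument expands powers of
  the homogeneous form \<open>t * x + (1 - t) * y\<close>.\<close>

lemma F0_triangular_sums: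
  assumes "\<beta> > 0" "(x, y) \<in> unit_square"
  shows "(\<lambda>N. \<Sum>i\<le>N. A0 \<beta> (i, N - i) * (x ^ i * y ^ (N - i))) sums F0 \<beta> (x, y)"
proof (rule has_sum_imp_sums, rule has_sum_SigmaD)
  let ?f = "\<lambda>n. A0 \<beta> n * mpow (x, y) n"
  have "bij_betw (\<lambda>(N, i :: nat). (i, N - i)) (SIGMA N:UNIV. {..N}) UNIV"
    by (rule bij_betwI[where g = "\<lambda>(i, j). (i + j, i)"]) auto
  from has_sum_reindex_bij_betw[OF this, of ?f "F0 \<beta> (x, y)"]
  show "((\<lambda>n. ?f (case n of (N, i) \<Rightarrow> (i, N - i))) has_sum F0 \<beta> (x, y)) (SIGMA N:UNIV. {..N})"
    using pser_has_sum[OF unit_conv_A0[OF assms(1)] assms(2)] by (simp add: F0_eq_pser)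
  show "((\<lambda>i. ?f (case (N, i) of (N, i) \<Rightarrow> (i, N - i))) has_sum
      (\<Sum>i\<le>N. A0 \<beta> (i, N - i) * (x ^ i * y ^ (N - i)))) {..N}" for N
    by (rule has_sum_finiteI) (auto simp: mpow_def)
qed

text \<open>The uniform lower bound for partial binomial sums is averaged first over
  \<open>t\<close> with law Beta(\<open>\<beta>\<close>, \<open>\<beta>\<close>), then over
  \<open>s\<close> with law Beta(\<open>2 * \<beta>\<close>, \<open>\<beta>\<close>), and the number
  of terms tends to infinity last.\<close>

lemma F0_pos_interior:
  assumes "\<beta> > 0" "(x, y) \<in> unit_square"
  shows "F0 \<beta> (x, y) > 0"
proof -
  define g where "g N = pochhammer (1 - \<beta>) N / fact N" for N :: nat
  define \<rho> where "\<rho> = max \<bar>x\<bar> \<bar>y\<bar>"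
  have "0 \<le> \<rho>" "\<rho> < 1" using assms by (auto simp: \<rho>_def)
  then obtain \<delta> K0 where \<delta>: "\<delta> > 0" "\<And>K z. K \<ge> K0 \<Longrightarrow> \<bar>z\<bar> \<le> \<rho> \<Longrightarrow> \<delta> \<le> (\<Sum>N<K. g N * z ^ N)"
    unfolding g_def using binomial_partial_sums_lower_bound by metis
  have ge: "\<delta> \<le> (\<Sum>N<K. \<Sum>i\<le>N. A0 \<beta> (i, N - i) * (x ^ i * y ^ (N - i)))" if K: "K \<ge> K0" for K
  proof -
    \<comment> \<open>The double sum becomes one sum over the pairs of degree \<open>N\<close> and
      exponent \<open>i\<close> of \<open>x\<close>. Below, \<open>c\<close> holds the coefficients
      of the binomial expansion and \<open>w\<close> the moments in \<open>t\<close>.\<close>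
    define I where "I = (SIGMA N:{..<K}. {..N})"
    have fin: "finite I" by (simp add: I_def)
    have le: "snd k \<le> fst k" if "k \<in> I" for k using that by (auto simp: I_def)
    define c where "c k = g (fst k) * real (fst k choose snd k) * (x ^ snd k * y ^ (fst k - snd k))"
      for k :: "nat \<times> nat"
    define w where "w k = pochhammer \<beta> (snd k) * pochhammer \<beta> (fst k - snd k) /
        pochhammer (\<beta> + \<beta>) (snd k + (fst k - snd k))" for k
    have t: "\<delta> \<le> (\<Sum>k\<in>I. (c k * s ^ fst k) * w k)" if s: "0 \<le> s" "s \<le> 1" for s
      unfolding w_def
    proof (rule beta_mean_lower_bound[OF assms(1) assms(1) fin])
      fix t :: real assume t: "0 \<le> t" "t \<le> 1"
      let ?z = "s * (t * x + (1 - t) * y)"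
      have "\<bar>t * x + (1 - t) * y\<bar> \<le> \<bar>t * x\<bar> + \<bar>(1 - t) * y\<bar>" by (rule abs_triangle_ineq)
      also have "\<dots> \<le> t * \<rho> + (1 - t) * \<rho>"
        unfolding abs_mult using t by (intro add_mono mult_mono) (auto simp: \<rho>_def)
      finally have "\<bar>t * x + (1 - t) * y\<bar> \<le> \<rho>" by (simp add: algebra_simps)
      hence "s * \<bar>t * x + (1 - t) * y\<bar> \<le> 1 * \<rho>"
        using s \<open>0 \<le> \<rho>\<close> by (intro mult_mono) auto
      hence "\<bar>?z\<bar> \<le> \<rho>" using s by (simp add: abs_mult)
      have "g N * ?z ^ N = (\<Sum>i\<le>N. c (N, i) * s ^ N * (t ^ i * (1 - t) ^ (N - i)))" for N
        unfolding power_mult_distrib[of s] binomial_ring sum_distrib_left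
        by (intro sum.cong) (simp_all add: c_def power_mult_distrib mult_ac)
      with \<delta>(2)[OF K \<open>\<bar>?z\<bar> \<le> \<rho>\<close>]
      have "\<delta> \<le> (\<Sum>N<K. \<Sum>i\<le>N. c (N, i) * s ^ N * (t ^ i * (1 - t) ^ (N - i)))"
        by simp
      also have "(\<Sum>N<K. \<Sum>i\<le>N. c (N, i) * s ^ N * (t ^ i * (1 - t) ^ (N - i)))
         = (\<Sum>k\<in>I. c k * s ^ fst k * (t ^ snd k * (1 - t) ^ (fst k - snd k)))"
        unfolding I_def by (subst sum.Sigma) (auto simp: case_prod_unfold)
      finally show "\<delta> \<le> (\<Sum>k\<in>I. c k * s ^ fst k * (t ^ snd k * (1 - t) ^ (fst k - snd k)))" .
    qed
    \<comment> \<open>The average over \<open>s\<close> uses only powers of \<open>s\<close>, hence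
      the second exponent 0.\<close>
    have "\<delta> \<le> (\<Sum>k\<in>I. (c k * w k) * (pochhammer (2 * \<beta>) (fst k) * pochhammer \<beta> 0 /
        pochhammer (2 * \<beta> + \<beta>) (fst k + 0)))"
    proof (rule beta_mean_lower_bound)
      show "\<delta> \<le> (\<Sum>k\<in>I. (c k * w k) * (s ^ fst k * (1 - s) ^ 0))" if "0 \<le> s" "s \<le> 1" for s
        using t[OF that] by (simp add: mult_ac)
    qed (use assms fin in auto)
    \<comment> \<open>The factor \<open>pochhammer (2 * \<beta>) N\<close> cancels between the two
      averages, and \<open>fact N\<close> between \<open>g N\<close> and the binomial
      coefficient.\<close>
    also have "\<dots> = (\<Sum>k\<in>I. A0 \<beta> (snd k, fst k - snd k) * (x ^ snd k * y ^ (fst k - snd k)))"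
    proof (rule sum.cong)
      fix k assume k: "k \<in> I"
      define N i where "N = fst k" and "i = snd k"
      have iN: "i \<le> N" using le[OF k] by (simp add: N_def i_def)
      have pos: "pochhammer (2 * \<beta>) N > 0" "pochhammer (3 * \<beta>) N > 0"
        using assms by (auto intro!: pochhammer_pos)
      have sums: "\<beta> + \<beta> = 2 * \<beta>" "2 * \<beta> + \<beta> = 3 * \<beta>" "i + (N - i) = N" using iN by auto
      show "(c k * w k) * (pochhammer (2 * \<beta>) (fst k) * pochhammer \<beta> 0 /
          pochhammer (2 * \<beta> + \<beta>) (fst k + 0)) = A0 \<beta> (snd k, fst k - snd k) * (x ^ snd k * y ^ (fst k - snd k))"
        unfolding c_def w_def g_def A0_def prod.case N_def[symmetric] i_def[symmetric] sums
          binomial_fact[OF iN] pochhammer_fact[symmetric]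
        using pos by simp
    qed simp
    also have "\<dots> = (\<Sum>N<K. \<Sum>i\<le>N. A0 \<beta> (i, N - i) * (x ^ i * y ^ (N - i)))"
      unfolding I_def by (subst sum.Sigma) (auto simp: case_prod_unfold)
    finally show ?thesis .
  qed
  have "(\<lambda>K. \<Sum>N<K. \<Sum>i\<le>N. A0 \<beta> (i, N - i) * (x ^ i * y ^ (N - i))) \<longlonglongrightarrow> F0 \<beta> (x, y)"
    using F0_triangular_sums[OF assms] by (simp add: sums_def)
  hence "\<delta> \<le> F0 \<beta> (x, y)"
    by (rule tendsto_lowerbound) (use ge in \<open>auto simp: eventually_at_top_linorder\<close>)
  with \<delta>(1) show ?thesis by simp
qed

section \<open>Absolute convergence up to the boundary\<close>

text \<open>The exponent \<open>1 - 4 * \<beta>\<close> is negative, so the joint factor is at most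
  its value at \<open>j = 0\<close>. This leaves \<open>(i + 1) powr (- (3 * \<beta>))\<close>,
  summable because \<open>3 * \<beta> > 1\<close>, while \<open>L ^ j\<close> takes care of
  \<open>j\<close>.\<close>

lemma A0_summable_weighted:
  assumes "\<beta> > 1/3" "0 \<le> L" "L < 1"
  shows "(\<lambda>n. \<bar>A0 \<beta> n\<bar> * L ^ snd n) summable_on UNIV"
proof -
  have \<beta>: "\<beta> > 0" using assms by simp
  obtain C where C: "C > 0"
    "\<And>i j. \<bar>A0 \<beta> (i, j)\<bar> \<le> C * ((real i + 1) powr (\<beta> - 1) * (real j + 1) powr (\<beta> - 1) *
        (real i + real j + 1) powr (1 - 4 * \<beta>))"
    using A0_bound[OF \<beta>] by blast
  define u v where "u n = (real n + 1) powr (- (3 * \<beta>))" and "v n = (real n + 1) powr (\<beta> - 1) * L ^ n" for n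
  have "(\<lambda>n. C * (u (fst n) * v (snd n))) summable_on UNIV"
    unfolding u_def v_def using assms
    by (intro summable_on_cmult_right summable_on_product summable_powr_times_power summable_Suc_powr) auto
  thus ?thesis
  proof (rule summable_on_comparison_test)
    fix n :: "nat \<times> nat"
    obtain i j where n: "n = (i, j)" by fastforce
    have "(real i + real j + 1) powr (1 - 4 * \<beta>) \<le> (real i + 1) powr (1 - 4 * \<beta>)"
      using assms by (intro powr_mono2') auto
    hence "(real i + 1) powr (\<beta> - 1) * (real j + 1) powr (\<beta> - 1) * (real i + real j + 1) powr (1 - 4 * \<beta>)
      \<le> (real i + 1) powr (\<beta> - 1) * (real j + 1) powr (\<beta> - 1) * (real i + 1) powr (1 - 4 * \<beta>)"
      by (intro mult_left_mono) auto
    also have "\<dots> = ((real i + 1) powr (\<beta> - 1) * (real i + 1) powr (1 - 4 * \<beta>)) * (real j + 1) powr (\<beta> - 1)"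
      by (simp only: mult_ac)
    also have "\<dots> = u i * (real j + 1) powr (\<beta> - 1)"
      unfolding powr_add[symmetric] u_def by simp
    finally have "\<bar>A0 \<beta> (i, j)\<bar> \<le> C * (u i * (real j + 1) powr (\<beta> - 1))"
      using C(1) by (intro order.trans[OF C(2)] mult_left_mono) auto
    from mult_right_mono[OF this, of "L ^ j"]
    show "\<bar>A0 \<beta> n\<bar> * L ^ snd n \<le> C * (u (fst n) * v (snd n))"
      using assms by (simp add: n v_def mult_ac)
  qed (use assms in auto)
qed

text \<open>The joint exponent \<open>1 - 4 * \<beta>\<close> is shared equally between
  \<open>i\<close> and \<open>j\<close>. Each index then has exponent
  \<open>- \<beta> - 1/2\<close>, which is below -1 for \<open>\<beta> > 1/2\<close>.\<close>

lemma A0_abs_summable: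
  assumes "\<beta> > 1/2"
  shows "(\<lambda>n. \<bar>A0 \<beta> n\<bar>) summable_on UNIV"
proof -
  have \<beta>: "\<beta> > 0" using assms by simp
  obtain C where C: "C > 0"
    "\<And>i j. \<bar>A0 \<beta> (i, j)\<bar> \<le> C * ((real i + 1) powr (\<beta> - 1) * (real j + 1) powr (\<beta> - 1) *
        (real i + real j + 1) powr (1 - 4 * \<beta>))"
    using A0_bound[OF \<beta>] by blast
  define u where "u n = (real n + 1) powr (- \<beta> - 1/2)" for n
  have "(\<lambda>n. C * (u (fst n) * u (snd n))) summable_on UNIV"
    unfolding u_def using assms
    by (intro summable_on_cmult_right summable_on_product summable_Suc_powr) auto
  thus ?thesis
  proof (rule summable_on_comparison_test)
    fix n :: "nat \<times> nat"
    obtain i j where n: "n = (i, j)" by fastforce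
    have "(real i + real j + 1) powr (1/2 - 2 * \<beta>) \<le> (real k + 1) powr (1/2 - 2 * \<beta>)" if "k \<le> i + j" for k
      using assms that by (intro powr_mono2') (auto simp flip: of_nat_add)
    hence "(real i + real j + 1) powr (1/2 - 2 * \<beta>) * (real i + real j + 1) powr (1/2 - 2 * \<beta>)
        \<le> (real i + 1) powr (1/2 - 2 * \<beta>) * (real j + 1) powr (1/2 - 2 * \<beta>)"
      by (intro mult_mono) auto
    also have "(real i + real j + 1) powr (1/2 - 2 * \<beta>) * (real i + real j + 1) powr (1/2 - 2 * \<beta>)
        = (real i + real j + 1) powr (1 - 4 * \<beta>)"
      unfolding powr_add[symmetric] by simp
    finally have "(real i + 1) powr (\<beta> - 1) * (real j + 1) powr (\<beta> - 1) * (real i + real j + 1) powr (1 - 4 * \<beta>)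
      \<le> (real i + 1) powr (\<beta> - 1) * (real j + 1) powr (\<beta> - 1) *
         ((real i + 1) powr (1/2 - 2 * \<beta>) * (real j + 1) powr (1/2 - 2 * \<beta>))"
      by (intro mult_left_mono) auto
    also have "\<dots> = ((real i + 1) powr (\<beta> - 1) * (real i + 1) powr (1/2 - 2 * \<beta>)) *
        ((real j + 1) powr (\<beta> - 1) * (real j + 1) powr (1/2 - 2 * \<beta>))"
      by (simp only: mult_ac)
    also have "\<dots> = u i * u j"
      unfolding powr_add[symmetric] u_def by (simp add: algebra_simps)
    finally show "\<bar>A0 \<beta> n\<bar> \<le> C * (u (fst n) * u (snd n))"
      using C(1) unfolding n fst_conv snd_conv by (intro order.trans[OF C(2)] mult_left_mono) auto
  qed auto
qed

section \<open>Row sums and boundary values\<close>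

definition boundary_const :: "real \<Rightarrow> real" where
  "boundary_const \<beta> = (Gamma (3 * \<beta>) * Gamma (3 * \<beta> - 1)) / (Gamma (2 * \<beta>) * Gamma (4 * \<beta> - 1))"

lemma boundary_const_pos: "\<beta> > 1/3 \<Longrightarrow> boundary_const \<beta> > 0"
  unfolding boundary_const_def by (intro divide_pos_pos mult_pos_pos Gamma_real_pos) auto

text \<open>After splitting the symbols at \<open>i + j\<close>, row \<open>i\<close> is a constant
  times a Gauss series at 1 with parameters depending on \<open>i\<close>. The excess
  \<open>c - a - b = 3 * \<beta> - 1\<close> does not depend on \<open>i\<close>, so one condition
  on \<open>\<beta>\<close> serves all rows.\<close>

lemma A0_row:
  assumes "\<beta> > 1/3"
  shows "summable (\<lambda>j. \<bar>A0 \<beta> (i, j)\<bar>)"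
    and "A_Sigma \<beta> i = boundary_const \<beta> * ((pochhammer \<beta> i * pochhammer (1 - \<beta>) i) / (pochhammer 1 i * pochhammer (2 * \<beta>) i))"
proof -
  define P where "P = pochhammer \<beta> i * pochhammer (1 - \<beta>) i / (pochhammer 1 i * pochhammer (3 * \<beta>) i)"
  define a b c where "a = \<beta>" and "b = 1 - \<beta> + real i" and "c = 3 * \<beta> + real i"
  have abc: "c > 0" "c - a - b > 0" using assms by (auto simp: a_def b_def c_def)
  define u where "u j = pochhammer a j * pochhammer b j / (pochhammer c j * fact j)" for j
  have A: "A0 \<beta> (i, j) = P * u j" for j
    unfolding A0_def prod.case pochhammer_product'[of _ i j] P_def u_def a_def b_def c_def pochhammer_fact
    by (simp add: mult_ac)
  have su: "summable (\<lambda>j. \<bar>u j\<bar>)"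
    unfolding u_def by (rule Gauss_summable[OF abc])
  show "summable (\<lambda>j. \<bar>A0 \<beta> (i, j)\<bar>)"
    unfolding A abs_mult by (intro summable_mult su)
  have "A_Sigma \<beta> i = P * Gauss_F a b c"
    unfolding A_Sigma_def A Gauss_F_def u_def[symmetric]
    by (rule suminf_mult[OF summable_rabs_cancel[OF su]])
  also have "Gauss_F a b c = Gamma c * Gamma (c - a - b) * rGamma (c - a) * rGamma (c - b)"
    by (rule Gauss_summation[OF abc])
  also have "c - a - b = 3 * \<beta> - 1" by (simp add: a_def b_def c_def)
  also have "c - a = 2 * \<beta> + real i" by (simp add: a_def c_def)
  also have "c - b = 4 * \<beta> - 1" by (simp add: b_def c_def)
  also have "Gamma c = pochhammer (3 * \<beta>) i * Gamma (3 * \<beta>)"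
    unfolding c_def using assms by (intro Gamma_plus_nat) auto
  also have "rGamma (2 * \<beta> + real i) = 1 / (pochhammer (2 * \<beta>) i * Gamma (2 * \<beta>))"
    using Gamma_plus_nat[of "2 * \<beta>" i] assms by (simp add: rGamma_inverse_Gamma field_simps)
  also have "rGamma (4 * \<beta> - 1) = 1 / Gamma (4 * \<beta> - 1)"
    by (simp add: rGamma_inverse_Gamma field_simps)
  finally show "A_Sigma \<beta> i = boundary_const \<beta> * ((pochhammer \<beta> i * pochhammer (1 - \<beta>) i) / (pochhammer 1 i * pochhammer (2 * \<beta>) i))"
    using pochhammer_pos[of "3 * \<beta>" i] assms by (simp add: P_def boundary_const_def mult_ac)
qed

text \<open>The double series is summed row by row. Summability is a hypothesis so that the formula
  covers both \<open>x < 1\<close> and, for \<open>\<beta> > 1/2\<close>, the corner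
  \<open>x = 1\<close>.\<close>

lemma F0_boundary_eq:
  assumes "\<beta> > 1/3" "(\<lambda>n. A0 \<beta> n * mpow (x, 1) n) summable_on UNIV"
  shows "F0 \<beta> (x, 1) = boundary_const \<beta> * (\<Sum>n. pochhammer (1 - \<beta>) n * pochhammer \<beta> n / (pochhammer (2 * \<beta>) n * fact n) * x ^ n)"
proof -
  define t where "t n = pochhammer (1 - \<beta>) n * pochhammer \<beta> n / (pochhammer (2 * \<beta>) n * fact n) * x ^ n" for n
  have "((\<lambda>n. A0 \<beta> n * mpow (x, 1) n) has_sum F0 \<beta> (x, 1)) (UNIV \<times> UNIV)"
    using has_sum_infsum[OF assms(2)] by (simp add: F0_def)
  moreover have "((\<lambda>j. A0 \<beta> (i, j) * mpow (x, 1) (i, j)) has_sum A_Sigma \<beta> i * x ^ i) UNIV" for i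
  proof -
    have "(A0 \<beta> \<circ> Pair i has_sum A_Sigma \<beta> i) UNIV"
      using A0_row(1)[OF assms(1), of i] summable_sums[OF summable_rabs_cancel[OF A0_row(1)[OF assms(1), of i]]]
      unfolding A_Sigma_def by (intro norm_summable_imp_has_sum) (auto simp: o_def)
    from has_sum_cmult_left[OF this, of "x ^ i"] show ?thesis by (simp add: mpow_def)
  qed
  ultimately have "((\<lambda>i. A_Sigma \<beta> i * x ^ i) has_sum F0 \<beta> (x, 1)) UNIV"
    by (rule has_sum_SigmaD)
  hence "(\<lambda>i. A_Sigma \<beta> i * x ^ i) sums F0 \<beta> (x, 1)"
    by (rule has_sum_imp_sums)
  moreover have "A_Sigma \<beta> i * x ^ i = boundary_const \<beta> * t i" for i
    unfolding A0_row(2)[OF assms(1)] t_def by (simp add: pochhammer_fact mult_ac)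
  ultimately have "(\<lambda>i. boundary_const \<beta> * t i) sums (boundary_const \<beta> * (F0 \<beta> (x, 1) / boundary_const \<beta>))"
    using boundary_const_pos[OF assms(1)] by simp
  hence "t sums (F0 \<beta> (x, 1) / boundary_const \<beta>)"
    using boundary_const_pos[OF assms(1)] by (subst (asm) sums_mult_iff) auto
  hence "suminf t = F0 \<beta> (x, 1) / boundary_const \<beta>" by (rule sums_unique[symmetric])
  thus ?thesis using boundary_const_pos[OF assms(1)] by (simp add: t_def [abs_def])
qed

section \<open>Continuity and positivity on the closed square\<close>

abbreviation (input) punctured_square :: "(real \<times> real) set" where
  "punctured_square \<equiv> {0..1} \<times> {0..1} - {(1, 1)}"

text \<open>The weighted majorant handles one strip, and its reflection by the symmetry of
  \<open>A0\<close> handles the other.\<close>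

lemma F0_strip:
  assumes "\<beta> > 1/3" "0 \<le> L" "L < 1"
  shows "continuous_on ({0..1} \<times> {0..L}) (F0 \<beta>)"
    and "continuous_on ({0..L} \<times> {0..1}) (F0 \<beta>)"
    and "r \<in> {0..1} \<times> {0..L} \<Longrightarrow> (\<lambda>n. A0 \<beta> n * mpow r n) summable_on UNIV"
    and "r \<in> {0..L} \<times> {0..1} \<Longrightarrow> (\<lambda>n. A0 \<beta> n * mpow r n) summable_on UNIV"
proof -
  have M: "(\<lambda>n. \<bar>A0 \<beta> n\<bar> * L ^ snd n) summable_on UNIV"
    by (rule A0_summable_weighted[OF assms])
  hence "(\<lambda>n. (\<lambda>n. \<bar>A0 \<beta> n\<bar> * L ^ snd n) (prod.swap n)) summable_on UNIV"
    by (subst summable_on_reindex_bij_betw) auto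
  hence M': "(\<lambda>n. \<bar>A0 \<beta> n\<bar> * L ^ fst n) summable_on UNIV"
    by (simp add: A0_swap)
  have le: "\<bar>A0 \<beta> n * mpow r n\<bar> \<le> \<bar>A0 \<beta> n\<bar> * L ^ snd n" if "r \<in> {0..1} \<times> {0..L}" for n r
  proof -
    have "mpow r n \<le> 1 * L ^ snd n"
      unfolding mpow_def using that assms by (intro mult_mono power_mono power_le_one) auto
    moreover have "mpow r n \<ge> 0" using that by (auto simp: mpow_def)
    ultimately show ?thesis by (simp add: abs_mult mult_left_mono)
  qed
  have le': "\<bar>A0 \<beta> n * mpow r n\<bar> \<le> \<bar>A0 \<beta> n\<bar> * L ^ fst n" if "r \<in> {0..L} \<times> {0..1}" for n r
  proof -
    have "mpow r n \<le> L ^ fst n * 1"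
      unfolding mpow_def using that assms by (intro mult_mono power_mono power_le_one) auto
    moreover have "mpow r n \<ge> 0" using that by (auto simp: mpow_def)
    ultimately show ?thesis by (simp add: abs_mult mult_left_mono)
  qed
  note 1 = pser_mtest[OF M le] and 2 = pser_mtest[OF M' le']
  show "continuous_on ({0..1} \<times> {0..L}) (F0 \<beta>)" "continuous_on ({0..L} \<times> {0..1}) (F0 \<beta>)"
    unfolding F0_eq_pser using 1(2) 2(2) by blast+
  show "r \<in> {0..1} \<times> {0..L} \<Longrightarrow> (\<lambda>n. A0 \<beta> n * mpow r n) summable_on UNIV"
    "r \<in> {0..L} \<times> {0..1} \<Longrightarrow> (\<lambda>n. A0 \<beta> n * mpow r n) summable_on UNIV"
    using 1(3) 2(3) by blast+
qed

text \<open>The strict inequality with \<open>L\<close> makes the strip a relative neighbourhood of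
  \<open>r\<close>, so continuity on strips yields continuity on the punctured square.\<close>

lemma punctured_square_cases:
  assumes "r \<in> punctured_square"
  obtains L where "0 \<le> L" "L < 1" "snd r < L" "r \<in> {0..1} \<times> {0..L}"
    | L where "0 \<le> L" "L < 1" "fst r < L" "r \<in> {0..L} \<times> {0..1}"
proof (cases "snd r < 1")
  case True
  then obtain L where "snd r < L" "L < 1" using dense by blast
  with that(1)[of L] assms show ?thesis by (cases r) auto
next
  case False
  hence "fst r < 1" using assms by (cases r) auto
  then obtain L where "fst r < L" "L < 1" using dense by blast
  with that(2)[of L] assms show ?thesis by (cases r) auto
qed

lemma F0_summable_punctured_square:
  assumes "\<beta> > 1/3" "r \<in> punctured_square"
  shows "(\<lambda>n. A0 \<beta> n * mpow r n) summable_on UNIV"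
  using assms(2) by (rule punctured_square_cases) (auto intro: F0_strip(3,4)[OF assms(1)])

lemma F0_continuous_punctured_square:
  assumes "\<beta> > 1/3"
  shows "continuous_on punctured_square (F0 \<beta>)"
  unfolding continuous_on_eq_continuous_within
proof
  fix r assume r: "r \<in> punctured_square"
  have *: "continuous (at r within punctured_square) (F0 \<beta>)"
    if "continuous_on T (F0 \<beta>)" "open U" "r \<in> U" "r \<in> T" "punctured_square \<inter> U \<subseteq> T" for T U
  proof -
    have "continuous (at r within (punctured_square \<inter> U)) (F0 \<beta>)"
      using that by (meson continuous_on_eq_continuous_within continuous_within_subset)
    moreover have "at r within (punctured_square \<inter> U) = at r within punctured_square"
      by (rule at_within_nhd[OF that(3,2)]) auto
    ultimately show ?thesis by simp
  qed
  from r show "continuous (at r within punctured_square) (F0 \<beta>)"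
  proof (cases rule: punctured_square_cases)
    case (1 L)
    show ?thesis
    proof (rule *[OF F0_strip(1)[OF assms 1(1,2)]])
      show "open (UNIV \<times> {..<L} :: (real \<times> real) set)" by (intro open_Times) auto
    qed (use 1 in \<open>auto simp: mem_Times_iff\<close>)
  next
    case (2 L)
    show ?thesis
    proof (rule *[OF F0_strip(2)[OF assms 2(1,2)]])
      show "open ({..<L} \<times> UNIV :: (real \<times> real) set)" by (intro open_Times) auto
    qed (use 2 in \<open>auto simp: mem_Times_iff\<close>)
  qed
qed

lemma F0_boundary:
  assumes "\<beta> > 1/3" "0 \<le> x" "x < 1"
  shows "F0 \<beta> (1, x) = boundary_const \<beta> * f_beta \<beta> x"
proof -
  have "(\<lambda>n. A0 \<beta> n * mpow (x, 1) n) summable_on UNIV"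
    using assms by (intro F0_summable_punctured_square) auto
  from F0_boundary_eq[OF assms(1) this] show ?thesis
    by (simp add: f_beta_eq F0_swap[of \<beta> 1 x])
qed

lemma F0_pos_punctured_square:
  assumes "\<beta> > 1/3" "r \<in> punctured_square"
  shows "F0 \<beta> r > 0"
proof -
  obtain x y where r: "r = (x, y)" by fastforce
  have bnd: "F0 \<beta> (1, z) > 0" if "0 \<le> z" "z < 1" for z
    using F0_boundary[OF assms(1) that] boundary_const_pos[OF assms(1)] f_beta_pos[of \<beta> z] that assms by simp
  consider "x < 1" "y < 1" | "x = 1" "y < 1" | "x < 1" "y = 1"
    using assms(2) r by fastforce
  thus ?thesis
  proof cases
    case 1
    thus ?thesis using F0_pos_interior[of \<beta> x y] assms r by auto
  next
    case 2
    thus ?thesis using bnd[of y] assms r by auto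
  next
    case 3
    thus ?thesis using bnd[of x] assms r F0_swap[of \<beta> 1 x] by auto
  qed
qed

lemma F0_continuous_square:
  assumes "\<beta> > 1/2"
  shows "continuous_on ({0..1} \<times> {0..1}) (F0 \<beta>)"
    and "r \<in> {0..1} \<times> {0..1} \<Longrightarrow> (\<lambda>n. A0 \<beta> n * mpow r n) summable_on UNIV"
proof -
  have le: "\<bar>A0 \<beta> n * mpow r n\<bar> \<le> \<bar>A0 \<beta> n\<bar>" if "r \<in> {0..1} \<times> {0..1}" for n r
    using abs_mpow_le[of r 1 n] that by (auto simp: abs_mult mult_left_le)
  note * = pser_mtest[OF A0_abs_summable[OF assms] le]
  show "continuous_on ({0..1} \<times> {0..1}) (F0 \<beta>)"
    unfolding F0_eq_pser using *(2) by blast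
  show "r \<in> {0..1} \<times> {0..1} \<Longrightarrow> (\<lambda>n. A0 \<beta> n * mpow r n) summable_on UNIV"
    using *(3) by blast
qed

text \<open>At \<open>x = 1\<close> the boundary series is itself a Gauss series, with excess
  \<open>2 * \<beta> - 1 > 0\<close>. The values of \<open>Gamma\<close> at
  \<open>2 * \<beta>\<close> and \<open>3 * \<beta> - 1\<close> cancel against
  \<open>boundary_const\<close>.\<close>

lemma F0_corner:
  assumes "\<beta> > 1/2"
  shows "F0 \<beta> (1, 1) = (Gamma (3 * \<beta>) * Gamma (2 * \<beta> - 1)) / (Gamma \<beta> * Gamma (4 * \<beta> - 1))"
proof -
  have nz: "Gamma (2 * \<beta>) \<noteq> 0" "Gamma (3 * \<beta> - 1) \<noteq> 0"
    using assms by (auto intro!: less_imp_neq[THEN not_sym] Gamma_real_pos)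
  have "F0 \<beta> (1, 1) = boundary_const \<beta> * Gauss_F (1 - \<beta>) \<beta> (2 * \<beta>)"
    using F0_boundary_eq[of \<beta> 1] F0_continuous_square(2)[OF assms, of "(1, 1)"] assms
    by (simp add: Gauss_F_def)
  also have "Gauss_F (1 - \<beta>) \<beta> (2 * \<beta>) = Gamma (2 * \<beta>) * Gamma (2 * \<beta> - 1) / (Gamma (3 * \<beta> - 1) * Gamma \<beta>)"
    using Gauss_summation[of "2 * \<beta>" "1 - \<beta>" \<beta>] assms
    by (simp add: rGamma_inverse_Gamma field_simps)
  finally show ?thesis
    using nz by (simp add: boundary_const_def)
qed

theorem proposition4p1:
  fixes \<beta> :: real
  shows
    "(\<beta> > 0 \<longrightarrow>
        has_sum_locally_uniformly (\<lambda>n r. A0 \<beta> n * mpow r n) (F0 \<beta>) ({-1<..<1} \<times> {-1<..<1}) \<and>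
        has_sum_locally_uniformly (\<lambda>n r. B0 \<beta> n * mpow r n) (G0 \<beta>) ({-1<..<1} \<times> {-1<..<1}) \<and>
        real_analytic2_on (F0 \<beta>) ({-1<..<1} \<times> {-1<..<1}) \<and>
        real_analytic2_on (G0 \<beta>) ({-1<..<1} \<times> {-1<..<1}) \<and>
        (\<forall>r1\<in>{-1<..<1}. \<forall>r2\<in>{-1<..<1}.
           F0 \<beta> (r1, r2) = F0 \<beta> (r2, r1) \<and>
           G0 \<beta> (r1, r2) = G0 \<beta> (r2, r1) \<and>
           r1 * (1 - r1) * pd1 (pd1 (F0 \<beta>)) (r1, r2) + (2 * \<beta> - 2 * r1) * pd1 (F0 \<beta>) (r1, r2)
             - \<beta> * (1 - \<beta>) * F0 \<beta> (r1, r2) = (1 - r2) * G0 \<beta> (r1, r2) \<and>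
           r2 * (1 - r2) * pd2 (pd2 (F0 \<beta>)) (r1, r2) + (2 * \<beta> - 2 * r2) * pd2 (F0 \<beta>) (r1, r2)
             - \<beta> * (1 - \<beta>) * F0 \<beta> (r1, r2) = (1 - r1) * G0 \<beta> (r1, r2) \<and>
           \<beta> * r1 * pd1 (F0 \<beta>) (r1, r2) - \<beta> * r2 * pd2 (F0 \<beta>) (r1, r2)
             = - (r1 - r2) * G0 \<beta> (r1, r2) \<and>
           \<beta> * r2 * pd2 (F0 \<beta>) (r1, r2) - \<beta> * r1 * pd1 (F0 \<beta>) (r1, r2)
             = - (r2 - r1) * G0 \<beta> (r1, r2) \<and>
           F0 \<beta> (r1, r2) = Appell_F1 (1 - \<beta>) \<beta> \<beta> (3 * \<beta>) r1 r2 \<and>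
           F0 \<beta> (r1, r2) > 0)) \<and>
     (\<beta> > 1/3 \<longrightarrow>
        (\<forall>L\<in>{0<..<1}. (\<lambda>(n1, n2). \<bar>A0 \<beta> (n1, n2)\<bar> * L ^ n2) summable_on UNIV) \<and>
        (\<forall>r \<in> {0..1} \<times> {0..1} - {(1, 1)}. (\<lambda>n. A0 \<beta> n * mpow r n) summable_on UNIV) \<and>
        continuous_on ({0..1} \<times> {0..1} - {(1, 1)}) (F0 \<beta>) \<and>
        (\<forall>r \<in> {0..1} \<times> {0..1} - {(1, 1)}. F0 \<beta> r > 0) \<and>
        (\<forall>n1. summable (\<lambda>n2. \<bar>A0 \<beta> (n1, n2)\<bar>) \<and>
           A_Sigma \<beta> n1 =
             (Gamma (3 * \<beta>) * Gamma (3 * \<beta> - 1)) / (Gamma (2 * \<beta>) * Gamma (4 * \<beta> - 1)) *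
             ((pochhammer \<beta> n1 * pochhammer (1 - \<beta>) n1) / (pochhammer 1 n1 * pochhammer (2 * \<beta>) n1))) \<and>
        (\<forall>x\<in>{0..<1}.
           F0 \<beta> (x, 1) = F0 \<beta> (1, x) \<and>
           F0 \<beta> (1, x) =
             (Gamma (3 * \<beta>) * Gamma (3 * \<beta> - 1)) / (Gamma (2 * \<beta>) * Gamma (4 * \<beta> - 1)) * f_beta \<beta> x)) \<and>
     (\<beta> > 1/2 \<longrightarrow>
        (\<lambda>n. \<bar>A0 \<beta> n\<bar>) summable_on UNIV \<and>
        continuous_on ({0..1} \<times> {0..1}) (F0 \<beta>) \<and>
        (\<forall>r \<in> {0..1} \<times> {0..1}. F0 \<beta> r > 0) \<and>
        F0 \<beta> (1, 1) = (Gamma (3 * \<beta>) * Gamma (2 * \<beta> - 1)) / (Gamma \<beta> * Gamma (4 * \<beta> - 1)))"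
proof (intro conjI impI)
  assume \<beta>: "\<beta> > 0"
  show "has_sum_locally_uniformly (\<lambda>n r. A0 \<beta> n * mpow r n) (F0 \<beta>) unit_square"
    "has_sum_locally_uniformly (\<lambda>n r. B0 \<beta> n * mpow r n) (G0 \<beta>) unit_square"
    unfolding F0_eq_pser G0_eq_pser
    by (intro pser_locally_uniformly unit_conv_A0 unit_conv_B0 \<beta>)+
  show "real_analytic2_on (F0 \<beta>) unit_square" "real_analytic2_on (G0 \<beta>) unit_square"
    unfolding F0_eq_pser G0_eq_pser by (intro pser_analytic unit_conv_A0 unit_conv_B0 \<beta>)+
next
  assume \<beta>: "\<beta> > 0"
  show "\<forall>r1\<in>{-1<..<1}. \<forall>r2\<in>{-1<..<1}.
           F0 \<beta> (r1, r2) = F0 \<beta> (r2, r1) \<and>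
           G0 \<beta> (r1, r2) = G0 \<beta> (r2, r1) \<and>
           r1 * (1 - r1) * pd1 (pd1 (F0 \<beta>)) (r1, r2) + (2 * \<beta> - 2 * r1) * pd1 (F0 \<beta>) (r1, r2)
             - \<beta> * (1 - \<beta>) * F0 \<beta> (r1, r2) = (1 - r2) * G0 \<beta> (r1, r2) \<and>
           r2 * (1 - r2) * pd2 (pd2 (F0 \<beta>)) (r1, r2) + (2 * \<beta> - 2 * r2) * pd2 (F0 \<beta>) (r1, r2)
             - \<beta> * (1 - \<beta>) * F0 \<beta> (r1, r2) = (1 - r1) * G0 \<beta> (r1, r2) \<and>
           \<beta> * r1 * pd1 (F0 \<beta>) (r1, r2) - \<beta> * r2 * pd2 (F0 \<beta>) (r1, r2)
             = - (r1 - r2) * G0 \<beta> (r1, r2) \<and>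
           \<beta> * r2 * pd2 (F0 \<beta>) (r1, r2) - \<beta> * r1 * pd1 (F0 \<beta>) (r1, r2)
             = - (r2 - r1) * G0 \<beta> (r1, r2) \<and>
           F0 \<beta> (r1, r2) = Appell_F1 (1 - \<beta>) \<beta> \<beta> (3 * \<beta>) r1 r2 \<and>
           F0 \<beta> (r1, r2) > 0"
  proof (intro ballI conjI)
    fix x y :: real assume "x \<in> {-1<..<1}" "y \<in> {-1<..<1}"
    hence xy: "(x, y) \<in> unit_square" and yx: "(y, x) \<in> unit_square" by auto
    show "F0 \<beta> (x, y) = F0 \<beta> (y, x)" "G0 \<beta> (x, y) = G0 \<beta> (y, x)"
      by (rule F0_swap, rule G0_swap)
    show "x * (1 - x) * pd1 (pd1 (F0 \<beta>)) (x, y) + (2 * \<beta> - 2 * x) * pd1 (F0 \<beta>) (x, y)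
             - \<beta> * (1 - \<beta>) * F0 \<beta> (x, y) = (1 - y) * G0 \<beta> (x, y)"
      by (rule F0_pde[OF \<beta> xy])
    \<comment> \<open>This is the equation for the first variable at \<open>(y, x)\<close>, carried
      over by symmetry.\<close>
    show "y * (1 - y) * pd2 (pd2 (F0 \<beta>)) (x, y) + (2 * \<beta> - 2 * y) * pd2 (F0 \<beta>) (x, y)
             - \<beta> * (1 - \<beta>) * F0 \<beta> (x, y) = (1 - x) * G0 \<beta> (x, y)"
      using F0_pde[OF \<beta> yx] unfolding pd2_F0 F0_swap[of \<beta> y x] G0_swap[of \<beta> y x] .
    show first: "\<beta> * x * pd1 (F0 \<beta>) (x, y) - \<beta> * y * pd2 (F0 \<beta>) (x, y) = - (x - y) * G0 \<beta> (x, y)"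
      unfolding pd2_F0 by (rule F0_pde_first_order[OF \<beta> xy])
    show "\<beta> * y * pd2 (F0 \<beta>) (x, y) - \<beta> * x * pd1 (F0 \<beta>) (x, y) = - (y - x) * G0 \<beta> (x, y)"
      using first by algebra
    show "F0 \<beta> (x, y) = Appell_F1 (1 - \<beta>) \<beta> \<beta> (3 * \<beta>) x y"
      unfolding F0_def Appell_F1_def
      by (intro infsum_cong) (auto simp: A0_def mpow_def pochhammer_fact mult_ac)
    show "F0 \<beta> (x, y) > 0" by (rule F0_pos_interior[OF \<beta> xy])
  qed
next
  assume \<beta>: "\<beta> > 1/3"
  show "\<forall>L\<in>{0<..<1}. (\<lambda>(n1, n2). \<bar>A0 \<beta> (n1, n2)\<bar> * L ^ n2) summable_on UNIV"
    using A0_summable_weighted[OF \<beta>] by (auto simp: case_prod_unfold)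
  show "\<forall>r \<in> punctured_square. (\<lambda>n. A0 \<beta> n * mpow r n) summable_on UNIV"
    using F0_summable_punctured_square[OF \<beta>] by blast
  show "continuous_on punctured_square (F0 \<beta>)"
    by (rule F0_continuous_punctured_square[OF \<beta>])
  show "\<forall>r \<in> punctured_square. F0 \<beta> r > 0"
    using F0_pos_punctured_square[OF \<beta>] by blast
  show "\<forall>n1. summable (\<lambda>n2. \<bar>A0 \<beta> (n1, n2)\<bar>) \<and>
           A_Sigma \<beta> n1 =
             (Gamma (3 * \<beta>) * Gamma (3 * \<beta> - 1)) / (Gamma (2 * \<beta>) * Gamma (4 * \<beta> - 1)) *
             ((pochhammer \<beta> n1 * pochhammer (1 - \<beta>) n1) / (pochhammer 1 n1 * pochhammer (2 * \<beta>) n1))"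
    using A0_row[OF \<beta>] unfolding boundary_const_def by blast
  show "\<forall>x\<in>{0..<1}.
           F0 \<beta> (x, 1) = F0 \<beta> (1, x) \<and>
           F0 \<beta> (1, x) =
             (Gamma (3 * \<beta>) * Gamma (3 * \<beta> - 1)) / (Gamma (2 * \<beta>) * Gamma (4 * \<beta> - 1)) * f_beta \<beta> x"
    using F0_swap F0_boundary[OF \<beta>] unfolding boundary_const_def by auto
next
  assume \<beta>: "\<beta> > 1/2"
  show "(\<lambda>n. \<bar>A0 \<beta> n\<bar>) summable_on UNIV"
    by (rule A0_abs_summable[OF \<beta>])
  show "continuous_on ({0..1} \<times> {0..1}) (F0 \<beta>)"
    by (rule F0_continuous_square(1)[OF \<beta>])
  show corner: "F0 \<beta> (1, 1) = (Gamma (3 * \<beta>) * Gamma (2 * \<beta> - 1)) / (Gamma \<beta> * Gamma (4 * \<beta> - 1))"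
    by (rule F0_corner[OF \<beta>])
  \<comment> \<open>At the corner positivity is read off from the closed form, all arguments of
    \<open>Gamma\<close> being positive.\<close>
  have "F0 \<beta> (1, 1) > 0"
    unfolding corner using \<beta> by (intro divide_pos_pos mult_pos_pos Gamma_real_pos) auto
  moreover have "F0 \<beta> r > 0" if "r \<in> punctured_square" for r
    using F0_pos_punctured_square[OF _ that] \<beta> by simp
  ultimately show "\<forall>r \<in> {0..1} \<times> {0..1}. F0 \<beta> r > 0"
    by (metis DiffI singletonD)
qed

end
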